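(* Let $G$ be an infinite noncyclic group, and suppose $\mathcal{A}=\{a_1,\ldots,a_n\}$ is a finite generating set for $G$ such that none of the elements $a_ia_j\in G$, for distinct $1\le i,j\le n$, is of order two. Then there exist an unlabeled Cayley graph of $G$ (with respect to some finite generating set, of cardinality $m$ say) and a nonatomic invariant probability measure $\mu\in\mathcal{I}(\Lambda)$, $\Lambda=\Lambda(\mathbb{F}_m)$, such that $f_*\mu=\delta_G$, where $\delta_G$ is the Dirac measure concentrated on that unlabeled Cayley graph and $f$ is the forgetful map sending a Schreier graph to its underlying unlabeled, undirected rooted graph.
   Context: Graphs may have loops and multiple edges; a loop contributes $2$ to the degree. For $m\ge 1$ let $\mathbb{F}_m=\langle b_1,\ldots,b_m\rangle$ be the free group of rank $m$. A Schreier graph of $\mathbb{F}_m$ is a connected rooted $2m$-regular graph whose edges are oriented and labeled with $b_1,\ldots,b_m$ so that every vertex has, for each $i$, precisely one incoming and one outgoing edge labeled $b_i$; $\Lambda(\mathbb{F}_m)$ is the set of isomorphism classes of Schreier graphs, isomorphisms preserving root, labels and orientations. Let $\Omega$ be the set of root-preserving isomorphism classes of connected rooted $2m$-regular graphs. Both spaces carry the compact topology whose base is given by the cylinder sets $\{(\Gamma,x): U_r(x)\cong U\}$, where $U_r(x)$ is the $r$-neighborhood of the root (labeled in the case of $\Lambda(\mathbb{F}_m)$), and $f:\Lambda(\mathbb{F}_m)\to\Omega$ forgets labels and orientations. The Cayley graph of $G$ with respect to a generating set $\{g_1,\ldots,g_m\}$ is the graph with vertex set $G$, rooted at the identity, with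 one edge directed from $g$ to $gg_i$ and labeled by the $i$-th generator for each $g\in G$ and each $1\le i\le m$ (so it is $2m$-regular); the unlabeled Cayley graph is the underlying undirected unlabeled rooted graph, an element of $\Omega$. Invariance: let $\mathcal{E}\subset\Lambda\times\Lambda$ be the equivalence relation with $(\Gamma,x)\sim(\Delta,y)$ iff $\Gamma,\Delta$ are isomorphic as unrooted Schreier graphs. A Borel probability measure $\mu$ on $\Lambda$ is invariant if the left and right counting measures $\widetilde\mu_\ell(E)=\int|E\cap\pi_\ell^{-1}(\Gamma)|\,d\mu(\Gamma)$ and $\widetilde\mu_r(E)=\int|E\cap\pi_r^{-1}(\Gamma)|\,d\mu(\Gamma)$ on $\mathcal{E}$ coincide, where $\pi_\ell,\pi_r$ are the projections of $\mathcal{E}$ onto the first and second coordinates; $\mathcal{I}(\Lambda)$ is the set of invariant measures. (Equivalently, $\mu$ is invariant under the action of $\mathbb{F}_m$ on $\Lambda$ by moving the root along labeled edges, i.e. under conjugation of the corresponding subgroups of $\mathbb{F}_m$.) *)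

theory Defs
  imports
    "HOL-Probability.Probability"
    "HOL-Algebra.Elementary_Groups"
    "HOL-Algebra.Multiplicative_Group"
    "HOL-Library.Uprod"
begin

section \<open>Rooted multigraphs and Schreier graphs\<close>

text \<open>The ends of an edge form an unordered pair; a loop at \<open>v\<close> is an edge with ends
  \<open>Upair v v\<close>. Only the values of \<open>ends\<close> (and of \<open>tail\<close>, \<open>head\<close>, \<open>label\<close>) on the edge set
  matter: all notions below are insensitive to the values elsewhere.\<close>

record ('v, 'e) rgraph =
  verts :: "'v set"
  edges :: "'e set"
  ends :: "'e \<Rightarrow> 'v uprod"
  base :: 'v

record ('v, 'e) lgraph = "('v, 'e) rgraph" +
  tail :: "'e \<Rightarrow> 'v"
  head :: "'e \<Rightarrow> 'v"
  label :: "'e \<Rightarrow> nat"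

definition adj :: "('v, 'e, 'z) rgraph_scheme \<Rightarrow> 'v rel" where
  "adj G = {(u, v). \<exists>e\<in>edges G. ends G e = Upair u v}"

definition incident :: "('v, 'e, 'z) rgraph_scheme \<Rightarrow> 'v \<Rightarrow> 'e set" where
  "incident G v = {e \<in> edges G. v \<in> set_uprod (ends G e)}"

text \<open>A loop contributes two to the degree.\<close>

definition degree :: "('v, 'e, 'z) rgraph_scheme \<Rightarrow> 'v \<Rightarrow> nat" where
  "degree G v = card (incident G v) + card {e \<in> edges G. ends G e = Upair v v}"

definition conn_rooted_regular :: "nat \<Rightarrow> ('v, 'e, 'z) rgraph_scheme \<Rightarrow> bool" where
  "conn_rooted_regular d G \<longleftrightarrow>
     (\<forall>e\<in>edges G. set_uprod (ends G e) \<subseteq> verts G) \<and>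
     base G \<in> verts G \<and>
     (\<forall>u\<in>verts G. \<forall>v\<in>verts G. (u, v) \<in> (adj G)\<^sup>*) \<and>
     (\<forall>v\<in>verts G. finite (incident G v) \<and> degree G v = d)"

text \<open>The generators \<open>b\<^sub>1, \<dots>, b\<^sub>m\<close> are represented by the labels \<open>0, \<dots>, m - 1\<close>.\<close>

definition schreier_graph :: "nat \<Rightarrow> ('v, 'e, 'z) lgraph_scheme \<Rightarrow> bool" where
  "schreier_graph m S \<longleftrightarrow>
     conn_rooted_regular (2 * m) S \<and>
     (\<forall>e\<in>edges S. ends S e = Upair (tail S e) (head S e) \<and> label S e < m) \<and>
     (\<forall>v\<in>verts S. \<forall>i<m.
        (\<exists>!e. e \<in> edges S \<and> tail S e = v \<and> label S e = i) \<and>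
        (\<exists>!e. e \<in> edges S \<and> head S e = v \<and> label S e = i))"

section \<open>Isomorphisms\<close>

definition graph_iso_map ::
    "('v \<Rightarrow> 'w) \<Rightarrow> ('e \<Rightarrow> 'f) \<Rightarrow>
     ('v, 'e, 'z) rgraph_scheme \<Rightarrow> ('w, 'f, 'y) rgraph_scheme \<Rightarrow> bool" where
  "graph_iso_map \<alpha> \<beta> G H \<longleftrightarrow>
     bij_betw \<alpha> (verts G) (verts H) \<and> bij_betw \<beta> (edges G) (edges H) \<and>
     (\<forall>e\<in>edges G. ends H (\<beta> e) = map_uprod \<alpha> (ends G e))"

definition labelled_iso_map ::
    "('v \<Rightarrow> 'w) \<Rightarrow> ('e \<Rightarrow> 'f) \<Rightarrow>
     ('v, 'e, 'z) lgraph_scheme \<Rightarrow> ('w, 'f, 'y) lgraph_scheme \<Rightarrow> bool" where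
  "labelled_iso_map \<alpha> \<beta> S T \<longleftrightarrow>
     graph_iso_map \<alpha> \<beta> S T \<and>
     (\<forall>e\<in>edges S. tail T (\<beta> e) = \<alpha> (tail S e) \<and> head T (\<beta> e) = \<alpha> (head S e) \<and>
                   label T (\<beta> e) = label S e)"

definition rooted_iso ::
    "('v, 'e, 'z) rgraph_scheme \<Rightarrow> ('w, 'f, 'y) rgraph_scheme \<Rightarrow> bool" where
  "rooted_iso G H \<longleftrightarrow> (\<exists>\<alpha> \<beta>. graph_iso_map \<alpha> \<beta> G H \<and> \<alpha> (base G) = base H)"

definition labelled_rooted_iso ::
    "('v, 'e, 'z) lgraph_scheme \<Rightarrow> ('w, 'f, 'y) lgraph_scheme \<Rightarrow> bool" where
  "labelled_rooted_iso S T \<longleftrightarrow> (\<exists>\<alpha> \<beta>. labelled_iso_map \<alpha> \<beta> S T \<and> \<alpha> (base S) = base T)"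

definition labelled_unrooted_iso ::
    "('v, 'e, 'z) lgraph_scheme \<Rightarrow> ('w, 'f, 'y) lgraph_scheme \<Rightarrow> bool" where
  "labelled_unrooted_iso S T \<longleftrightarrow> (\<exists>\<alpha> \<beta>. labelled_iso_map \<alpha> \<beta> S T)"

section \<open>The spaces of isomorphism classes\<close>

text \<open>A connected graph of finite degrees has countably many vertices and edges, so every
  isomorphism class is represented by a graph whose vertices and edges are natural numbers.
  Isomorphism classes are formed among these representatives.\<close>

definition Omega :: "nat \<Rightarrow> (nat, nat) rgraph set set" where
  "Omega m = {G. conn_rooted_regular (2 * m) G} //
     {(G, H). conn_rooted_regular (2 * m) G \<and> conn_rooted_regular (2 * m) H \<and> rooted_iso G H}"

definition Lam :: "nat \<Rightarrow> (nat, nat) lgraph set set" where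
  "Lam m = {S. schreier_graph m S} //
     {(S, T). schreier_graph m S \<and> schreier_graph m T \<and> labelled_rooted_iso S T}"

text \<open>The class in \<open>Omega m\<close> of a graph with arbitrary types of vertices and edges, which may
  also carry labels and orientations; these are ignored.\<close>

definition unlabelled_class ::
    "nat \<Rightarrow> ('v, 'e, 'z) rgraph_scheme \<Rightarrow> (nat, nat) rgraph set" where
  "unlabelled_class m G = {H. conn_rooted_regular (2 * m) H \<and> rooted_iso G H}"

definition forget :: "nat \<Rightarrow> (nat, nat) lgraph set \<Rightarrow> (nat, nat) rgraph set" where
  "forget m C = (\<Union>S\<in>C. unlabelled_class m S)"

section \<open>Topology and Borel structure\<close>

text \<open>The \<open>r\<close>-neighbourhood of the root is the subgraph induced on the vertices at distance at
  most \<open>r\<close> from it.\<close>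

definition root_ball :: "nat \<Rightarrow> ('v, 'e, 'z) rgraph_scheme \<Rightarrow> 'v set" where
  "root_ball r G = {v. \<exists>k\<le>r. (base G, v) \<in> adj G ^^ k}"

definition nbhd ::
    "nat \<Rightarrow> ('v, 'e, 'z) rgraph_scheme \<Rightarrow> ('v, 'e, 'z) rgraph_scheme" where
  "nbhd r G = G\<lparr>verts := root_ball r G,
                edges := {e \<in> edges G. set_uprod (ends G e) \<subseteq> root_ball r G}\<rparr>"

definition cylinder_Omega :: "nat \<Rightarrow> nat \<Rightarrow> (nat, nat) rgraph \<Rightarrow> (nat, nat) rgraph set set" where
  "cylinder_Omega m r U = {C \<in> Omega m. \<exists>G\<in>C. rooted_iso (nbhd r G) U}"

definition cylinder_Lam :: "nat \<Rightarrow> nat \<Rightarrow> (nat, nat) lgraph \<Rightarrow> (nat, nat) lgraph set set" where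
  "cylinder_Lam m r U = {C \<in> Lam m. \<exists>S\<in>C. labelled_rooted_iso (nbhd r S) U}"

definition topology_Omega :: "nat \<Rightarrow> (nat, nat) rgraph set topology" where
  "topology_Omega m = topology_generated_by {cylinder_Omega m r U |r U. True}"

definition topology_Lam :: "nat \<Rightarrow> (nat, nat) lgraph set topology" where
  "topology_Lam m = topology_generated_by {cylinder_Lam m r U |r U. True}"

definition borel_of_topology :: "'x topology \<Rightarrow> 'x measure" where
  "borel_of_topology X = sigma (topspace X) {U. openin X U}"

section \<open>Invariant measures\<close>

definition schreier_rel :: "nat \<Rightarrow> (nat, nat) lgraph set rel" where
  "schreier_rel m =
     {(C, D). C \<in> Lam m \<and> D \<in> Lam m \<and> (\<exists>S\<in>C. \<exists>T\<in>D. labelled_unrooted_iso S T)}"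

definition left_counting :: "'x measure \<Rightarrow> 'x rel \<Rightarrow> ennreal" where
  "left_counting \<mu> E = (\<integral>\<^sup>+ x. emeasure (count_space UNIV) {p \<in> E. fst p = x} \<partial>\<mu>)"

definition right_counting :: "'x measure \<Rightarrow> 'x rel \<Rightarrow> ennreal" where
  "right_counting \<mu> E = (\<integral>\<^sup>+ x. emeasure (count_space UNIV) {p \<in> E. snd p = x} \<partial>\<mu>)"

definition invariant_measures :: "nat \<Rightarrow> (nat, nat) lgraph set measure set" where
  "invariant_measures m =
     {\<mu>. prob_space \<mu> \<and> sets \<mu> = sets (borel_of_topology (topology_Lam m)) \<and>
         (\<forall>E \<in> sets (restrict_space (\<mu> \<Otimes>\<^sub>M \<mu>) (schreier_rel m)).
            left_counting \<mu> E = right_counting \<mu> E)}"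

definition nonatomic :: "'x measure \<Rightarrow> bool" where
  "nonatomic \<mu> \<longleftrightarrow>
     (\<forall>A\<in>sets \<mu>. emeasure \<mu> A > 0 \<longrightarrow>
        (\<exists>B\<in>sets \<mu>. B \<subseteq> A \<and> 0 < emeasure \<mu> B \<and> emeasure \<mu> B < emeasure \<mu> A))"

section \<open>Cayley graphs\<close>

text \<open>The edge \<open>(g, i)\<close> leads from \<open>g\<close> to the product of \<open>g\<close> with the \<open>i\<close>-th generator. In
  particular, a generator of order two yields double edges, and the unit yields loops.\<close>

definition cayley_graph :: "('a, 'b) monoid_scheme \<Rightarrow> 'a list \<Rightarrow> ('a, 'a \<times> nat) lgraph" where
  "cayley_graph G gs =
     \<lparr>verts = carrier G,
      edges = carrier G \<times> {..<length gs},
      ends = (\<lambda>(g, i). Upair g (g \<otimes>\<^bsub>G\<^esub> gs ! i)),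
      base = \<one>\<^bsub>G\<^esub>,
      tail = fst,
      head = (\<lambda>(g, i). g \<otimes>\<^bsub>G\<^esub> gs ! i),
      label = snd\<rparr>"

end

theory Submission
  imports Defs
begin

text \<open>
  The idea is to randomise the labels of a Cayley graph without touching the graph. Let \<open>a \<noteq> 1\<close>
  generate a cyclic subgroup of infinite index, and take a generating list that starts with \<open>1\<close>, \<open>a\<close>
  and whose remaining members already generate \<open>G\<close>. At each left coset of \<open>\<langle>a\<rangle>\<close> the edges labelled \<open>0\<close> are
  loops, one at each vertex, and the edges labelled \<open>1\<close> form a line or a cycle through the coset.
  Toss a fair coin for each coset and exchange the labels \<open>0\<close> and \<open>1\<close> at the cosets whose coin shows
  heads. Both labels still permute the vertices, so the result is a Schreier graph
  (\<open>schreier_graph_flipped\<close>), and its underlying rooted graph is the Cayley graph whatever the coins show.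
  Let the measure be the law of this random Schreier graph. Its image under \<open>forget\<close> is a Dirac
  measure.

  The law is nonatomic since the coins can be read off from the isomorphism class: walks along the
  remaining generators are not affected by the coins, so a fixed walk leads to any given
  coset, and there the loop is labelled \<open>0\<close> or \<open>1\<close> (\<open>coin_word\<close>). Infinitely many fair coins give a
  measure without atoms (\<open>coin_splits_event\<close>).

  The law is invariant since moving the root of the flipped graph to \<open>g\<close> amounts, after a left
  translation by \<open>g\<^sup>-\<^sup>1\<close>, to a permutation of the coins. Thus the equivalence classes correspond to
  the orbits of a countable group of measure preserving bijections (\<open>schreier_rel_flipped_class\<close>), and
  for orbits the two counting measures agree (\<open>mass_transport\<close>). To transfer this to \<open>Lam m\<close> one
  needs that the functions that are integrated there are measurable. A Schreier graph is determined
  by the set of words that label closed walks at its root, and for each word this is a clopen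
  condition; so equality of points of \<open>Lam m\<close> is a countable conjunction of Borel conditions, and the
  flipped graphs form a Borel set on which the coins are a Borel function
  (\<open>AE_flipped_law_in_range_flipped_class\<close>).

  It remains to find \<open>a\<close>. If all nontrivial cyclic subgroups of \<open>G\<close> had finite index, then \<open>G\<close> would be
  torsion-free with a central infinite cyclic subgroup \<open>\<langle>z\<rangle>\<close> of finite index. The transfer homomorphism
  to \<open>\<langle>z\<rangle>\<close> would be injective, hence \<open>G\<close> would be cyclic
  (\<open>cyclic_if_cyclic_subgroups_finite_index\<close>).
\<close>

section \<open>Isomorphisms\<close>

definition ends_in_verts :: "('v, 'e, 'z) rgraph_scheme \<Rightarrow> bool" where
  "ends_in_verts G \<longleftrightarrow> (\<forall>e\<in>edges G. set_uprod (ends G e) \<subseteq> verts G)"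

lemma ends_in_vertsD: "ends_in_verts G \<Longrightarrow> e \<in> edges G \<Longrightarrow> v \<in> set_uprod (ends G e) \<Longrightarrow> v \<in> verts G"
  unfolding ends_in_verts_def by blast

lemma ends_in_verts_nbhd: "ends_in_verts (nbhd r G)"
  unfolding ends_in_verts_def nbhd_def by auto

lemma conn_rooted_regularD:
  assumes "conn_rooted_regular d G"
  shows "ends_in_verts G" "base G \<in> verts G"
    "\<And>u v. u \<in> verts G \<Longrightarrow> v \<in> verts G \<Longrightarrow> (u, v) \<in> (adj G)\<^sup>*"
  using assms unfolding conn_rooted_regular_def ends_in_verts_def by auto

lemma graph_iso_map_id: "graph_iso_map id id G G"
  unfolding graph_iso_map_def by (auto simp: uprod.map_id)

lemma graph_iso_map_inv:
  assumes "graph_iso_map \<alpha> \<beta> G H" "ends_in_verts G"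
  shows "graph_iso_map (inv_into (verts G) \<alpha>) (inv_into (edges G) \<beta>) H G"
proof -
  have a: "bij_betw \<alpha> (verts G) (verts H)" and b: "bij_betw \<beta> (edges G) (edges H)"
    and e: "\<And>e. e \<in> edges G \<Longrightarrow> ends H (\<beta> e) = map_uprod \<alpha> (ends G e)"
    using assms(1) by (auto simp: graph_iso_map_def)
  have "ends G (inv_into (edges G) \<beta> f) = map_uprod (inv_into (verts G) \<alpha>) (ends H f)"
    if f: "f \<in> edges H" for f
  proof -
    define e' where "e' = inv_into (edges G) \<beta> f"
    have e': "e' \<in> edges G" "\<beta> e' = f"
      using b f unfolding e'_def bij_betw_def
      by (auto simp: inv_into_into f_inv_into_f)
    have "map_uprod (inv_into (verts G) \<alpha>) (ends H f) =
          map_uprod (inv_into (verts G) \<alpha> \<circ> \<alpha>) (ends G e')"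
      using e[OF e'(1)] e'(2) by (simp add: uprod.map_comp)
    also have "\<dots> = map_uprod id (ends G e')"
      using a assms(2) e'(1) by (intro uprod.map_cong0)
        (auto simp: bij_betw_def dest!: ends_in_vertsD)
    finally show ?thesis by (simp add: e'_def uprod.map_id)
  qed
  then show ?thesis
    using a b unfolding graph_iso_map_def by (auto intro: bij_betw_inv_into)
qed

lemma graph_iso_map_comp:
  assumes "graph_iso_map \<alpha> \<beta> G H" "graph_iso_map \<gamma> \<delta> H K"
  shows "graph_iso_map (\<gamma> \<circ> \<alpha>) (\<delta> \<circ> \<beta>) G K"
  using assms unfolding graph_iso_map_def
  by (auto intro: bij_betw_trans simp: uprod.map_comp bij_betw_apply)

lemma rooted_iso_refl: "rooted_iso G G"
  unfolding rooted_iso_def using graph_iso_map_id by fastforce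

lemma rooted_iso_sym:
  assumes "rooted_iso G H" "ends_in_verts G" "base G \<in> verts G"
  shows "rooted_iso H G"
proof -
  obtain \<alpha> \<beta> where *: "graph_iso_map \<alpha> \<beta> G H" "\<alpha> (base G) = base H"
    using assms(1) unfolding rooted_iso_def by auto
  have "inv_into (verts G) \<alpha> (base H) = base G"
    using * assms(3) by (metis bij_betw_inv_into_left graph_iso_map_def)
  then show ?thesis
    using graph_iso_map_inv[OF *(1) assms(2)] unfolding rooted_iso_def by blast
qed

lemma rooted_iso_trans: "rooted_iso G H \<Longrightarrow> rooted_iso H K \<Longrightarrow> rooted_iso G K"
  unfolding rooted_iso_def by (metis graph_iso_map_comp comp_apply)

definition directed_ends :: "('v, 'e, 'z) lgraph_scheme \<Rightarrow> bool" where
  "directed_ends S \<longleftrightarrow> (\<forall>e\<in>edges S. ends S e = Upair (tail S e) (head S e))"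

lemma directed_ends_nbhd: "directed_ends S \<Longrightarrow> directed_ends (nbhd r S)"
  unfolding directed_ends_def nbhd_def by auto

lemma labelled_iso_map_id: "labelled_iso_map id id S S"
  unfolding labelled_iso_map_def by (auto simp: graph_iso_map_id)

lemma labelled_iso_map_inv:
  assumes "labelled_iso_map \<alpha> \<beta> S T" "ends_in_verts S" "directed_ends S"
  shows "labelled_iso_map (inv_into (verts S) \<alpha>) (inv_into (edges S) \<beta>) T S"
proof -
  have g: "graph_iso_map \<alpha> \<beta> S T" using assms(1) by (simp add: labelled_iso_map_def)
  have a: "bij_betw \<alpha> (verts S) (verts T)" and b: "bij_betw \<beta> (edges S) (edges T)"
    using g by (auto simp: graph_iso_map_def)
  have "tail S (inv_into (edges S) \<beta> f) = inv_into (verts S) \<alpha> (tail T f) \<and>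
     head S (inv_into (edges S) \<beta> f) = inv_into (verts S) \<alpha> (head T f) \<and>
     label S (inv_into (edges S) \<beta> f) = label T f"
    if f: "f \<in> edges T" for f
  proof -
    obtain e where e: "e \<in> edges S" "f = \<beta> e" using b f by (auto simp: bij_betw_def)
    have "tail S e \<in> verts S" "head S e \<in> verts S"
      using assms(2,3) e(1) by (auto simp: directed_ends_def ends_in_verts_def)
    then show ?thesis
      using assms(1) e a b by (auto simp: labelled_iso_map_def bij_betw_def)
  qed
  then show ?thesis
    unfolding labelled_iso_map_def using graph_iso_map_inv[OF g assms(2)] by blast
qed

lemma labelled_iso_map_comp:
  assumes "labelled_iso_map \<alpha> \<beta> G H" "labelled_iso_map \<gamma> \<delta> H K"
  shows "labelled_iso_map (\<gamma> \<circ> \<alpha>) (\<delta> \<circ> \<beta>) G K"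
proof -
  have "\<beta> e \<in> edges H" if "e \<in> edges G" for e
    using assms(1) that by (auto simp: labelled_iso_map_def graph_iso_map_def bij_betw_def)
  then show ?thesis
    using assms unfolding labelled_iso_map_def by (auto intro: graph_iso_map_comp)
qed

lemma labelled_rooted_iso_refl: "labelled_rooted_iso S S"
  unfolding labelled_rooted_iso_def using labelled_iso_map_id by fastforce

lemma labelled_rooted_iso_sym:
  assumes "labelled_rooted_iso S T" "ends_in_verts S" "directed_ends S" "base S \<in> verts S"
  shows "labelled_rooted_iso T S"
proof -
  obtain \<alpha> \<beta> where *: "labelled_iso_map \<alpha> \<beta> S T" "\<alpha> (base S) = base T"
    using assms(1) unfolding labelled_rooted_iso_def by auto
  have "inv_into (verts S) \<alpha> (base T) = base S"
    using * assms(4) by (metis bij_betw_inv_into_left graph_iso_map_def labelled_iso_map_def)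
  then show ?thesis
    using labelled_iso_map_inv[OF *(1) assms(2,3)] unfolding labelled_rooted_iso_def by blast
qed

lemma labelled_rooted_iso_trans:
  "labelled_rooted_iso S T \<Longrightarrow> labelled_rooted_iso T U \<Longrightarrow> labelled_rooted_iso S U"
  unfolding labelled_rooted_iso_def by (metis labelled_iso_map_comp comp_apply)

lemma labelled_rooted_iso_imp_rooted_iso: "labelled_rooted_iso S T \<Longrightarrow> rooted_iso S T"
  unfolding labelled_rooted_iso_def rooted_iso_def labelled_iso_map_def by blast

section \<open>Neighbourhoods of the root\<close>

lemma base_in_root_ball: "base G \<in> root_ball r G"
  unfolding root_ball_def by (auto intro: exI[of _ 0])

lemma base_nbhd [simp]: "base (nbhd r G) = base G"
  by (simp add: nbhd_def)

lemma root_ball_Suc: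
  "v \<in> root_ball r G \<Longrightarrow> (v, w) \<in> adj G \<Longrightarrow> w \<in> root_ball (Suc r) G"
  unfolding root_ball_def mem_Collect_eq using relpow_Suc_I Suc_le_mono by metis

lemma root_ball_subset_verts:
  assumes "ends_in_verts G" "base G \<in> verts G"
  shows "root_ball r G \<subseteq> verts G"
proof -
  have "v \<in> verts G" if "(base G, v) \<in> adj G ^^ k" for k v
    using that assms
    by (cases k) (auto simp: adj_def dest: ends_in_vertsD)
  then show ?thesis unfolding root_ball_def by auto
qed

lemma finite_root_ball:
  assumes "conn_rooted_regular d G"
  shows "finite (root_ball r G)"
proof (induction r)
  case 0
  have "root_ball 0 G = {base G}" by (auto simp: root_ball_def)
  then show ?case by simp
next
  case (Suc r)
  have sub: "root_ball r G \<subseteq> verts G"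
    using root_ball_subset_verts conn_rooted_regularD[OF assms] by blast
  have "v \<in> root_ball r G \<union> (\<Union>u\<in>root_ball r G. \<Union>e\<in>incident G u. set_uprod (ends G e))"
    if "v \<in> root_ball (Suc r) G" for v
  proof -
    obtain k where k: "k \<le> Suc r" "(base G, v) \<in> adj G ^^ k"
      using \<open>v \<in> root_ball (Suc r) G\<close> unfolding root_ball_def by blast
    show ?thesis
    proof (cases "k \<le> r")
      case True
      then show ?thesis using k by (auto simp: root_ball_def)
    next
      case False
      then have "k = Suc r" using k by simp
      then obtain u where u: "(base G, u) \<in> adj G ^^ r" "(u, v) \<in> adj G" using k(2) by auto
      then obtain e where "e \<in> edges G" "ends G e = Upair u v" by (auto simp: adj_def)
      moreover have "u \<in> root_ball r G" using u(1) by (auto simp: root_ball_def)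
      ultimately show ?thesis by (force simp: incident_def)
    qed
  qed
  moreover have "finite (incident G u)" if "u \<in> root_ball r G" for u
    using assms sub that unfolding conn_rooted_regular_def by blast
  ultimately show ?case
    using Suc by (intro finite_subset[of "root_ball (Suc r) G" "root_ball r G \<union> (\<Union>u\<in>root_ball r G. \<Union>e\<in>incident G u. set_uprod (ends G e))"]) auto
qed

lemma adj_graph_iso: "graph_iso_map \<alpha> \<beta> G H \<Longrightarrow> (u, v) \<in> adj G \<Longrightarrow> (\<alpha> u, \<alpha> v) \<in> adj H"
  unfolding adj_def graph_iso_map_def bij_betw_def by fastforce

lemma root_ball_graph_iso:
  assumes "graph_iso_map \<alpha> \<beta> G H" "\<alpha> (base G) = base H" "v \<in> root_ball r G"
  shows "\<alpha> v \<in> root_ball r H"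
proof -
  have "(\<alpha> (base G), \<alpha> v) \<in> adj H ^^ k" if "(base G, v) \<in> adj G ^^ k" for k
    using that by (induction k arbitrary: v) (auto intro: adj_graph_iso[OF assms(1)])
  then show ?thesis using assms(2,3) unfolding root_ball_def by auto
qed

text \<open>Both inclusions between the image of a ball and a ball come from the fact that isomorphisms do not
  increase distances; one is applied to the inverse.\<close>

lemma graph_iso_map_nbhd:
  assumes iso: "graph_iso_map \<alpha> \<beta> G H" and base: "\<alpha> (base G) = base H"
    and G: "ends_in_verts G" "base G \<in> verts G"
  shows "graph_iso_map \<alpha> \<beta> (nbhd r G) (nbhd r H)"
proof -
  let ?\<alpha> = "inv_into (verts G) \<alpha>"
  have a: "bij_betw \<alpha> (verts G) (verts H)" and b: "bij_betw \<beta> (edges G) (edges H)"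
    and e: "\<And>e. e \<in> edges G \<Longrightarrow> ends H (\<beta> e) = map_uprod \<alpha> (ends G e)"
    using iso by (auto simp: graph_iso_map_def)
  note sub = root_ball_subset_verts[OF G, of r]
  have "?\<alpha> (base H) = base G"
    using a base G(2) by (metis bij_betw_inv_into_left)
  then have ballH: "?\<alpha> w \<in> root_ball r G" if "w \<in> root_ball r H" for w
    using root_ball_graph_iso[OF graph_iso_map_inv[OF iso G(1)]] that by blast
  have subH: "root_ball r H \<subseteq> verts H"
  proof (rule root_ball_subset_verts)
    show "base H \<in> verts H" using a base G(2) by (metis bij_betwE)
    show "ends_in_verts H" unfolding ends_in_verts_def
    proof
      fix f assume "f \<in> edges H"
      then obtain e' where e': "e' \<in> edges G" "f = \<beta> e'" using b by (auto simp: bij_betw_def)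
      then show "set_uprod (ends H f) \<subseteq> verts H"
        using e[OF e'(1)] G(1) a by (auto simp: uprod.set_map bij_betw_def dest: ends_in_vertsD)
    qed
  qed
  have img: "\<alpha> ` root_ball r G = root_ball r H"
  proof
    show "\<alpha> ` root_ball r G \<subseteq> root_ball r H"
      using root_ball_graph_iso[OF iso base] by auto
    show "root_ball r H \<subseteq> \<alpha> ` root_ball r G"
    proof
      fix w assume w: "w \<in> root_ball r H"
      then have "\<alpha> (?\<alpha> w) = w" using subH a by (metis bij_betw_inv_into_right subsetD)
      then show "w \<in> \<alpha> ` root_ball r G" using ballH[OF w] by (metis imageI)
    qed
  qed
  have pull: "v \<in> root_ball r G" if "v \<in> verts G" "\<alpha> v \<in> root_ball r H" for v
    using ballH[OF that(2)] bij_betw_inv_into_left[OF a that(1)] by simp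
  have "\<beta> ` {e \<in> edges G. set_uprod (ends G e) \<subseteq> root_ball r G} =
      {e \<in> edges H. set_uprod (ends H e) \<subseteq> root_ball r H}" (is "_ ` ?E = ?F")
  proof
    show "\<beta> ` ?E \<subseteq> ?F"
      using bij_betw_imp_surj_on[OF b] e by (auto simp: uprod.set_map intro!: root_ball_graph_iso[OF iso base])
    show "?F \<subseteq> \<beta> ` ?E"
    proof
      fix f assume f: "f \<in> ?F"
      then obtain e' where e': "e' \<in> edges G" "f = \<beta> e'" using b by (auto simp: bij_betw_def)
      have "set_uprod (ends G e') \<subseteq> root_ball r G"
      proof
        fix v assume v: "v \<in> set_uprod (ends G e')"
        then have "\<alpha> v \<in> root_ball r H" using f e' e[OF e'(1)] by (auto simp: uprod.set_map)
        then show "v \<in> root_ball r G" by (rule pull[OF ends_in_vertsD[OF G(1) e'(1) v]])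
      qed
      then show "f \<in> \<beta> ` ?E" using e' by auto
    qed
  qed
  then show ?thesis
    unfolding graph_iso_map_def nbhd_def bij_betw_def
    using img e inj_on_subset[OF bij_betw_imp_inj_on[OF a] sub]
      inj_on_subset[OF bij_betw_imp_inj_on[OF b]] by auto
qed

lemma labelled_iso_map_nbhd:
  assumes iso: "labelled_iso_map \<alpha> \<beta> S T" and base: "\<alpha> (base S) = base T"
    and S: "ends_in_verts S" "base S \<in> verts S"
  shows "labelled_iso_map \<alpha> \<beta> (nbhd r S) (nbhd r T)"
  using graph_iso_map_nbhd[of \<alpha> \<beta> S T r] assms
  unfolding labelled_iso_map_def by (auto simp: nbhd_def)

lemma rooted_iso_nbhd:
  assumes "rooted_iso G H" "ends_in_verts G" "base G \<in> verts G"
  shows "rooted_iso (nbhd r G) (nbhd r H)"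
  using assms graph_iso_map_nbhd unfolding rooted_iso_def by fastforce

lemma labelled_rooted_iso_nbhd:
  assumes "labelled_rooted_iso S T" "ends_in_verts S" "base S \<in> verts S"
  shows "labelled_rooted_iso (nbhd r S) (nbhd r T)"
  using assms labelled_iso_map_nbhd unfolding labelled_rooted_iso_def by fastforce

lemma labelled_rooted_iso_nbhd_sym:
  assumes "labelled_rooted_iso (nbhd r S) T" "directed_ends S"
  shows "labelled_rooted_iso T (nbhd r S)"
  using assms by (intro labelled_rooted_iso_sym[OF assms(1)])
    (auto simp: ends_in_verts_nbhd directed_ends_nbhd, simp add: nbhd_def base_in_root_ball)

section \<open>Schreier graphs\<close>

lemma schreier_graphD:
  assumes "schreier_graph m S"
  shows "ends_in_verts S" "base S \<in> verts S" "directed_ends S"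
    "\<And>u v. u \<in> verts S \<Longrightarrow> v \<in> verts S \<Longrightarrow> (u, v) \<in> (adj S)\<^sup>*"
    "\<And>e. e \<in> edges S \<Longrightarrow> tail S e \<in> verts S \<and> head S e \<in> verts S \<and> label S e < m"
    "\<And>v i. v \<in> verts S \<Longrightarrow> i < m \<Longrightarrow> \<exists>!e. e \<in> edges S \<and> tail S e = v \<and> label S e = i"
    "\<And>v i. v \<in> verts S \<Longrightarrow> i < m \<Longrightarrow> \<exists>!e. e \<in> edges S \<and> head S e = v \<and> label S e = i"
  using assms conn_rooted_regularD[of "2 * m" S] unfolding schreier_graph_def directed_ends_def
  by (auto dest: ends_in_vertsD)

text \<open>The degree condition is implied by the labelling: the edges leaving \<open>v\<close> and those entering
  \<open>v\<close> are each enumerated by the labels, and the two sets have exactly the loops in common.\<close>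

lemma schreier_graphI:
  assumes "directed_ends S" "base S \<in> verts S"
    and conn: "\<And>u v. u \<in> verts S \<Longrightarrow> v \<in> verts S \<Longrightarrow> (u, v) \<in> (adj S)\<^sup>*"
    and e: "\<And>e. e \<in> edges S \<Longrightarrow> tail S e \<in> verts S \<and> head S e \<in> verts S \<and> label S e < m"
    and out: "\<And>v i. v \<in> verts S \<Longrightarrow> i < m \<Longrightarrow> \<exists>!e. e \<in> edges S \<and> tail S e = v \<and> label S e = i"
    and inc: "\<And>v i. v \<in> verts S \<Longrightarrow> i < m \<Longrightarrow> \<exists>!e. e \<in> edges S \<and> head S e = v \<and> label S e = i"
  shows "schreier_graph m S"
proof -
  have ends: "\<And>e. e \<in> edges S \<Longrightarrow> ends S e = Upair (tail S e) (head S e)"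
    using assms(1) by (auto simp: directed_ends_def)
  have deg: "finite (incident S v) \<and> degree S v = 2 * m" if v: "v \<in> verts S" for v
  proof -
    define Out where "Out = {e \<in> edges S. tail S e = v}"
    define In where "In = {e \<in> edges S. head S e = v}"
    have "bij_betw (label S) Out {..<m}"
      unfolding bij_betw_def inj_on_def Out_def using out[OF v] e by (auto simp: image_iff) metis+
    moreover have "bij_betw (label S) In {..<m}"
      unfolding bij_betw_def inj_on_def In_def using inc[OF v] e by (auto simp: image_iff) metis+
    ultimately have c: "card Out = m" "card In = m" "finite Out" "finite In"
      by (auto dest: bij_betw_same_card simp: bij_betw_finite)
    have "incident S v = Out \<union> In"
      unfolding incident_def Out_def In_def by (auto simp: ends)
    moreover have "{e \<in> edges S. ends S e = Upair v v} = Out \<inter> In"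
      unfolding Out_def In_def by (auto simp: ends)
    ultimately show ?thesis
      unfolding degree_def using c card_Un_Int[of Out In] by simp
  qed
  show ?thesis
    unfolding schreier_graph_def conn_rooted_regular_def
    using assms(2) conn e out inc deg ends by auto
qed

lemma schreier_graph_iso:
  assumes S: "schreier_graph m S" and iso: "labelled_iso_map \<alpha> \<beta> S T" and b: "base T \<in> verts T"
  shows "schreier_graph m T"
proof -
  note SD = schreier_graphD[OF S]
  have g: "graph_iso_map \<alpha> \<beta> S T" using iso by (simp add: labelled_iso_map_def)
  have av: "\<alpha> ` verts S = verts T" and ai: "inj_on \<alpha> (verts S)"
    and be: "\<beta> ` edges S = edges T" and bi: "inj_on \<beta> (edges S)"
    using g by (auto simp: graph_iso_map_def bij_betw_def)
  have lab: "ends T (\<beta> e) = map_uprod \<alpha> (ends S e)" "tail T (\<beta> e) = \<alpha> (tail S e)"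
     "head T (\<beta> e) = \<alpha> (head S e)" "label T (\<beta> e) = label S e" if "e \<in> edges S" for e
    using iso that by (auto simp: labelled_iso_map_def graph_iso_map_def)
  show ?thesis
  proof (rule schreier_graphI)
    show "directed_ends T"
      unfolding directed_ends_def be[symmetric] using SD(3) by (auto simp: lab directed_ends_def)
    show "(u, v) \<in> (adj T)\<^sup>*" if uv: "u \<in> verts T" "v \<in> verts T" for u v
    proof -
      obtain u' v' where *: "u' \<in> verts S" "v' \<in> verts S" "u = \<alpha> u'" "v = \<alpha> v'"
        using uv unfolding av[symmetric] by (elim imageE)
      have "(\<alpha> u', \<alpha> v') \<in> (adj T)\<^sup>*"
        using SD(4)[OF *(1,2)]
        by (induction) (auto intro: rtrancl_into_rtrancl adj_graph_iso[OF g])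
      then show ?thesis using * by simp
    qed
    show "tail T f \<in> verts T \<and> head T f \<in> verts T \<and> label T f < m" if "f \<in> edges T" for f
      using that SD(5) unfolding be[symmetric] av[symmetric] by (auto simp: lab)
    fix v i assume v: "v \<in> verts T" and i: "i < m"
    obtain v' where v': "v' \<in> verts S" "v = \<alpha> v'" using v av by auto
    show "\<exists>!e. e \<in> edges T \<and> tail T e = v \<and> label T e = i"
    proof -
      obtain e where e: "e \<in> edges S" "tail S e = v'" "label S e = i"
        and u: "\<And>e'. e' \<in> edges S \<Longrightarrow> tail S e' = v' \<Longrightarrow> label S e' = i \<Longrightarrow> e' = e"
        using SD(6)[OF v'(1) i] by blast
      have "f = \<beta> e" if f: "f \<in> edges T" "tail T f = v" "label T f = i" for f
      proof -
        obtain e' where e': "e' \<in> edges S" "f = \<beta> e'" using f(1) unfolding be[symmetric] by (elim imageE)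
        then have "\<alpha> (tail S e') = \<alpha> v'" using f(2) v'(2) by (simp add: lab)
        then have "tail S e' = v'" using SD(5)[OF e'(1)] v'(1) ai by (simp add: inj_on_eq_iff)
        then show ?thesis using u[OF e'(1)] f(3) e' by (simp add: lab)
      qed
      then show ?thesis
        using e v'(2) be by (intro ex1I[of _ "\<beta> e"]) (auto simp: lab)
    qed
    show "\<exists>!e. e \<in> edges T \<and> head T e = v \<and> label T e = i"
    proof -
      obtain e where e: "e \<in> edges S" "head S e = v'" "label S e = i"
        and u: "\<And>e'. e' \<in> edges S \<Longrightarrow> head S e' = v' \<Longrightarrow> label S e' = i \<Longrightarrow> e' = e"
        using SD(7)[OF v'(1) i] by blast
      have "f = \<beta> e" if f: "f \<in> edges T" "head T f = v" "label T f = i" for f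
      proof -
        obtain e' where e': "e' \<in> edges S" "f = \<beta> e'" using f(1) unfolding be[symmetric] by (elim imageE)
        then have "\<alpha> (head S e') = \<alpha> v'" using f(2) v'(2) by (simp add: lab)
        then have "head S e' = v'" using SD(5)[OF e'(1)] v'(1) ai by (simp add: inj_on_eq_iff)
        then show ?thesis using u[OF e'(1)] f(3) e' by (simp add: lab)
      qed
      then show ?thesis
        using e v'(2) be by (intro ex1I[of _ "\<beta> e"]) (auto simp: lab)
    qed
  qed (rule b)
qed

text \<open>Points of \<open>Lam m\<close> are classes of graphs on natural numbers. This lemma makes it possible to work
  with Schreier graphs whose vertices are group elements.\<close>

lemma schreier_graph_nat_copy:
  assumes S: "schreier_graph m S" and "countable (verts S)" "countable (edges S)"
  obtains T :: "(nat, nat) lgraph" where "schreier_graph m T" "labelled_rooted_iso S T"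
proof -
  define \<alpha> where "\<alpha> = to_nat_on (verts S)"
  define \<beta> where "\<beta> = to_nat_on (edges S)"
  define \<delta> where "\<delta> = inv_into (edges S) \<beta>"
  define T :: "(nat, nat) lgraph" where
    "T = \<lparr>verts = \<alpha> ` verts S, edges = \<beta> ` edges S, ends = (\<lambda>f. map_uprod \<alpha> (ends S (\<delta> f))),
          base = \<alpha> (base S), tail = (\<lambda>f. \<alpha> (tail S (\<delta> f))), head = (\<lambda>f. \<alpha> (head S (\<delta> f))),
          label = (\<lambda>f. label S (\<delta> f))\<rparr>"
  have inj: "inj_on \<alpha> (verts S)" "inj_on \<beta> (edges S)"
    using assms(2,3) by (auto simp: \<alpha>_def \<beta>_def)
  have "\<delta> (\<beta> e) = e" if "e \<in> edges S" for e
    using inj(2) that by (simp add: \<delta>_def)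
  then have iso: "labelled_iso_map \<alpha> \<beta> S T"
    using inj by (auto simp: labelled_iso_map_def graph_iso_map_def T_def bij_betw_def)
  show ?thesis
  proof (rule that)
    show "schreier_graph m T"
      by (rule schreier_graph_iso[OF S iso]) (use schreier_graphD(2)[OF S] in \<open>simp add: T_def\<close>)
    show "labelled_rooted_iso S T"
      using iso unfolding labelled_rooted_iso_def by (intro exI[of _ \<alpha>] exI[of _ \<beta>]) (simp add: T_def)
  qed
qed

section \<open>Walks\<close>

text \<open>A letter \<open>(i, True)\<close> stands for the generator with label \<open>i\<close>, and \<open>(i, False)\<close> for its
  inverse.\<close>

definition step :: "('v, 'e, 'z) lgraph_scheme \<Rightarrow> nat \<times> bool \<Rightarrow> 'v \<Rightarrow> 'v" where
  "step S l v =
    (if snd l then head S (THE e. e \<in> edges S \<and> tail S e = v \<and> label S e = fst l)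
     else tail S (THE e. e \<in> edges S \<and> head S e = v \<and> label S e = fst l))"

definition walk_from :: "('v, 'e, 'z) lgraph_scheme \<Rightarrow> 'v \<Rightarrow> (nat \<times> bool) list \<Rightarrow> 'v" where
  "walk_from S = foldl (\<lambda>v l. step S l v)"

abbreviation walk :: "('v, 'e, 'z) lgraph_scheme \<Rightarrow> (nat \<times> bool) list \<Rightarrow> 'v" where
  "walk S \<equiv> walk_from S (base S)"

definition words :: "nat \<Rightarrow> (nat \<times> bool) list set" where
  "words m = lists ({..<m} \<times> UNIV)"

definition inverse_word :: "(nat \<times> bool) list \<Rightarrow> (nat \<times> bool) list" where
  "inverse_word w = rev (map (\<lambda>(i, b). (i, \<not> b)) w)"

definition closed_walk :: "('v, 'e, 'z) lgraph_scheme \<Rightarrow> (nat \<times> bool) list \<Rightarrow> bool" where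
  "closed_walk S w \<longleftrightarrow> walk S w = base S"

lemma walk_from_simps [simp]:
  "walk_from S v [] = v" "walk_from S v (l # w) = walk_from S (step S l v) w"
  "walk_from S v (u @ w) = walk_from S (walk_from S v u) w"
  by (simp_all add: walk_from_def)

lemma words_simps [simp]:
  "[] \<in> words m" "(l # w) \<in> words m \<longleftrightarrow> fst l < m \<and> w \<in> words m"
  "u @ w \<in> words m \<longleftrightarrow> u \<in> words m \<and> w \<in> words m"
  by (cases l; auto simp: words_def)+

lemma countable_words: "countable (words m)"
  unfolding words_def by (intro countable_lists countableI_type)

lemma inverse_word_in_words [simp]: "inverse_word w \<in> words m \<longleftrightarrow> w \<in> words m"
  unfolding inverse_word_def words_def by (auto simp: in_lists_conv_set)

lemma step_forward:
  assumes "schreier_graph m S" "e \<in> edges S"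
  shows "step S (label S e, True) (tail S e) = head S e"
proof -
  have "(THE e'. e' \<in> edges S \<and> tail S e' = tail S e \<and> label S e' = label S e) = e"
    using assms schreier_graphD(5,6)[OF assms(1)] by (intro the1_equality) auto
  then show ?thesis by (simp add: step_def)
qed

lemma step_backward:
  assumes "schreier_graph m S" "e \<in> edges S"
  shows "step S (label S e, False) (head S e) = tail S e"
proof -
  have "(THE e'. e' \<in> edges S \<and> head S e' = head S e \<and> label S e' = label S e) = e"
    using assms schreier_graphD(5,7)[OF assms(1)] by (intro the1_equality) auto
  then show ?thesis by (simp add: step_def)
qed

lemma step_edge:
  assumes "schreier_graph m S" "v \<in> verts S" "i < m"
  obtains e where "e \<in> edges S" "label S e = i" "ends S e = Upair v (step S (i, b) v)"
    "if b then tail S e = v \<and> head S e = step S (i, b) v else head S e = v \<and> tail S e = step S (i, b) v"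
proof (cases b)
  case True
  then show ?thesis
    using schreier_graphD(6)[OF assms] that step_forward[OF assms(1)] schreier_graphD(3)[OF assms(1)]
    by (auto simp: directed_ends_def)
next
  case False
  then show ?thesis
    using schreier_graphD(7)[OF assms] that step_backward[OF assms(1)] schreier_graphD(3)[OF assms(1)]
    by (auto simp: directed_ends_def)
qed

lemma step_in_verts: "schreier_graph m S \<Longrightarrow> v \<in> verts S \<Longrightarrow> i < m \<Longrightarrow> step S (i, b) v \<in> verts S"
  using step_edge[of m S v i b] by (metis schreier_graphD(5))

lemma step_adj: "schreier_graph m S \<Longrightarrow> v \<in> verts S \<Longrightarrow> i < m \<Longrightarrow> (v, step S (i, b) v) \<in> adj S"
  using step_edge[of m S v i b] by (auto simp: adj_def)

lemma step_inverse:
  assumes "schreier_graph m S" "v \<in> verts S" "i < m"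
  shows "step S (i, \<not> b) (step S (i, b) v) = v"
proof -
  obtain e where "e \<in> edges S" "label S e = i"
    "if b then tail S e = v \<and> head S e = step S (i, b) v else head S e = v \<and> tail S e = step S (i, b) v"
    using step_edge[OF assms, of b] by metis
  then show ?thesis
    using step_forward[OF assms(1)] step_backward[OF assms(1)] by (cases b) metis+
qed

lemma walk_from_in_verts:
  "schreier_graph m S \<Longrightarrow> v \<in> verts S \<Longrightarrow> w \<in> words m \<Longrightarrow> walk_from S v w \<in> verts S"
  by (induction w arbitrary: v) (auto simp: step_in_verts)

lemma walk_from_inverse_word:
  "schreier_graph m S \<Longrightarrow> v \<in> verts S \<Longrightarrow> w \<in> words m \<Longrightarrow>
    walk_from S (walk_from S v w) (inverse_word w) = v"
  by (induction w arbitrary: v)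
    (auto simp: inverse_word_def step_inverse step_in_verts)

lemma walk_from_inj:
  assumes "schreier_graph m S" "u \<in> verts S" "v \<in> verts S" "w \<in> words m"
  shows "walk_from S u w = walk_from S v w \<longleftrightarrow> u = v"
  using walk_from_inverse_word[OF assms(1) _ assms(4)] assms(2,3) by metis

lemma closed_walk_append_inverse_word:
  assumes S: "schreier_graph m S" and w: "u \<in> words m" "w \<in> words m"
  shows "closed_walk S (u @ inverse_word w) \<longleftrightarrow> walk S u = walk S w"
proof -
  have v: "walk S u \<in> verts S" "walk S w \<in> verts S"
    using walk_from_in_verts[OF S schreier_graphD(2)[OF S]] w by auto
  have "closed_walk S (u @ inverse_word w) \<longleftrightarrow>
      walk_from S (walk S u) (inverse_word w) = walk_from S (walk S w) (inverse_word w)"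
    using walk_from_inverse_word[OF S schreier_graphD(2)[OF S] w(2)] by (simp add: closed_walk_def)
  also have "\<dots> \<longleftrightarrow> walk S u = walk S w"
    using w by (intro walk_from_inj[OF S v]) auto
  finally show ?thesis .
qed

lemma walk_surj:
  assumes S: "schreier_graph m S" and v: "v \<in> verts S"
  obtains w where "w \<in> words m" "walk S w = v"
proof -
  have "\<exists>w\<in>words m. walk S w = v"
    using schreier_graphD(4)[OF S schreier_graphD(2)[OF S] v]
  proof induction
    case base
    show ?case by (intro bexI[of _ "[]"]) auto
  next
    case (step x y)
    then obtain w where w: "w \<in> words m" "walk S w = x" by auto
    from step(2) obtain e where e: "e \<in> edges S" "ends S e = Upair x y" by (auto simp: adj_def)
    then have *: "Upair (tail S e) (head S e) = Upair x y"
      using schreier_graphD(3)[OF S] by (auto simp: directed_ends_def)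
    have l: "label S e < m" using schreier_graphD(5)[OF S e(1)] by simp
    from * consider "tail S e = x" "head S e = y" | "head S e = x" "tail S e = y" by auto
    then show ?case
    proof cases
      case 1
      then show ?thesis using w l step_forward[OF S e(1)]
        by (intro bexI[of _ "w @ [(label S e, True)]"]) auto
    next
      case 2
      then show ?thesis using w l step_backward[OF S e(1)]
        by (intro bexI[of _ "w @ [(label S e, False)]"]) auto
    qed
  qed
  then show ?thesis using that by auto
qed

lemma walk_in_root_ball:
  assumes S: "schreier_graph m S"
  shows "w \<in> words m \<Longrightarrow> length w \<le> r \<Longrightarrow> walk S w \<in> root_ball r S"
proof (induction w arbitrary: r rule: rev_induct)
  case Nil
  then show ?case by (simp add: base_in_root_ball)
next
  case (snoc l w)
  then obtain r' where r': "r = Suc r'" "length w \<le> r'" by (cases r) auto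
  have "(walk S w, step S l (walk S w)) \<in> adj S"
    using snoc.prems step_adj[OF S walk_from_in_verts[OF S schreier_graphD(2)[OF S]], of w "fst l" "snd l"]
    by auto
  then show ?case
    using root_ball_Suc[OF snoc.IH[of r']] snoc.prems r' by auto
qed

text \<open>A walk of length at most \<open>r\<close> does not leave the \<open>r\<close>-neighbourhood of the root and is determined there
  by its labels. Hence isomorphic neighbourhoods have the same short closed walks, so the closed walks
  are a continuous invariant of a Schreier graph.\<close>

lemma walk_nbhd_iso:
  assumes S: "schreier_graph m S" and T: "schreier_graph m T"
    and iso: "labelled_iso_map \<alpha> \<beta> (nbhd r S) (nbhd r T)" and base: "\<alpha> (base S) = base T"
  shows "w \<in> words m \<Longrightarrow> length w \<le> r \<Longrightarrow> \<alpha> (walk S w) = walk T w"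
proof (induction w rule: rev_induct)
  case Nil
  then show ?case by (simp add: base)
next
  case (snoc l w)
  obtain i b where l: "l = (i, b)" by (cases l)
  let ?v = "walk S w"
  have w: "w \<in> words m" and i: "i < m" using snoc.prems l by auto
  have v: "?v \<in> verts S" using walk_from_in_verts[OF S schreier_graphD(2)[OF S] w] .
  obtain e where e: "e \<in> edges S" "label S e = i" "ends S e = Upair ?v (step S (i, b) ?v)"
    "if b then tail S e = ?v \<and> head S e = step S (i, b) ?v else head S e = ?v \<and> tail S e = step S (i, b) ?v"
    using step_edge[OF S v i] by metis
  have ball: "?v \<in> root_ball r S" "step S (i, b) ?v \<in> root_ball r S"
    using walk_in_root_ball[OF S w, of r] walk_in_root_ball[OF S snoc.prems] snoc.prems l by auto
  have en: "e \<in> edges (nbhd r S)" using e ball by (simp add: nbhd_def)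
  then have "\<beta> e \<in> edges (nbhd r T)"
    using iso by (auto simp: labelled_iso_map_def graph_iso_map_def bij_betw_def)
  then have bT: "\<beta> e \<in> edges T" by (simp add: nbhd_def)
  have lab: "tail T (\<beta> e) = \<alpha> (tail S e)" "head T (\<beta> e) = \<alpha> (head S e)" "label T (\<beta> e) = i"
    using iso en e(2) by (auto simp: labelled_iso_map_def nbhd_def)
  have "\<alpha> ?v = walk T w" using snoc by auto
  then show ?case
    using e(4) lab step_forward[OF T bT] step_backward[OF T bT] l by (auto split: if_splits)
qed

lemma closed_walk_nbhd_iso:
  assumes S: "schreier_graph m S" and T: "schreier_graph m T"
    and iso: "labelled_rooted_iso (nbhd r S) (nbhd r T)" and w: "w \<in> words m" "length w \<le> r"
  shows "closed_walk S w \<longleftrightarrow> closed_walk T w"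
proof -
  obtain \<alpha> \<beta> where *: "labelled_iso_map \<alpha> \<beta> (nbhd r S) (nbhd r T)" "\<alpha> (base S) = base T"
    using iso by (auto simp: labelled_rooted_iso_def)
  have "inj_on \<alpha> (root_ball r S)"
    using * by (auto simp: labelled_iso_map_def graph_iso_map_def nbhd_def bij_betw_def)
  then have "\<alpha> (walk S w) = \<alpha> (base S) \<longleftrightarrow> walk S w = base S"
    using walk_in_root_ball[OF S w] base_in_root_ball by (metis inj_onD)
  then show ?thesis
    using walk_nbhd_iso[OF S T * w] *(2) by (simp add: closed_walk_def)
qed

lemma closed_walk_iso:
  assumes "schreier_graph m S" "schreier_graph m T" "labelled_rooted_iso S T" "w \<in> words m"
  shows "closed_walk S w \<longleftrightarrow> closed_walk T w"
  using closed_walk_nbhd_iso[OF assms(1,2) labelled_rooted_iso_nbhd[OF assms(3)] assms(4) order_refl]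
    schreier_graphD[OF assms(1)] by simp

text \<open>A Schreier graph is the coset graph of the subgroup of its closed words, so this subgroup
  determines it.\<close>

lemma labelled_rooted_iso_if_closed_walks_eq:
  assumes S: "schreier_graph m S" and T: "schreier_graph m T"
    and eq: "\<And>w. w \<in> words m \<Longrightarrow> closed_walk S w \<longleftrightarrow> closed_walk T w"
  shows "labelled_rooted_iso S T"
proof -
  note SD = schreier_graphD[OF S] and TD = schreier_graphD[OF T]
  have weq: "walk S u = walk S w \<longleftrightarrow> walk T u = walk T w" if "u \<in> words m" "w \<in> words m" for u w
    using closed_walk_append_inverse_word[OF S that] closed_walk_append_inverse_word[OF T that]
      eq[of "u @ inverse_word w"] that by simp
  \<comment> \<open>The only possible isomorphism sends the end of a walk in \<open>S\<close> to the end of the walk in \<open>T\<close> with the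
    same labels.\<close>
  define \<alpha> where "\<alpha> v = walk T (SOME w. w \<in> words m \<and> walk S w = v)" for v
  have \<alpha>: "\<alpha> (walk S w) = walk T w" if w: "w \<in> words m" for w
  proof -
    have "(SOME u. u \<in> words m \<and> walk S u = walk S w) \<in> words m \<and>
        walk S (SOME u. u \<in> words m \<and> walk S u = walk S w) = walk S w"
      by (rule someI[of _ w]) (use w in simp)
    then show ?thesis unfolding \<alpha>_def using weq w by blast
  qed
  have \<alpha>_step: "\<alpha> (step S (i, True) v) = step T (i, True) (\<alpha> v)" if v: "v \<in> verts S" "i < m" for v i
  proof -
    obtain w where w: "w \<in> words m" "walk S w = v" using walk_surj[OF S v(1)] .
    show ?thesis using \<alpha>[of "w @ [(i, True)]"] \<alpha>[of w] w v by auto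
  qed
  have a: "bij_betw \<alpha> (verts S) (verts T)"
    unfolding bij_betw_def
  proof
    show "inj_on \<alpha> (verts S)"
      by (rule inj_onI) (metis \<alpha> weq walk_surj[OF S])
    show "\<alpha> ` verts S = verts T"
    proof
      show "\<alpha> ` verts S \<subseteq> verts T"
        using \<alpha> walk_surj[OF S] walk_from_in_verts[OF T TD(2)] by (metis image_subsetI)
      show "verts T \<subseteq> \<alpha> ` verts S"
        using \<alpha> walk_surj[OF T] walk_from_in_verts[OF S SD(2)] by (metis image_eqI subsetI)
    qed
  qed
  define \<beta> where "\<beta> e = (THE f. f \<in> edges T \<and> tail T f = \<alpha> (tail S e) \<and> label T f = label S e)" for e
  have \<beta>: "\<beta> e \<in> edges T" "tail T (\<beta> e) = \<alpha> (tail S e)" "label T (\<beta> e) = label S e"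
    if e: "e \<in> edges S" for e
  proof -
    have "\<exists>!f. f \<in> edges T \<and> tail T f = \<alpha> (tail S e) \<and> label T f = label S e"
      using SD(5)[OF e] a by (intro TD(6)) (auto simp: bij_betw_def)
    from theI'[OF this] show "\<beta> e \<in> edges T" "tail T (\<beta> e) = \<alpha> (tail S e)" "label T (\<beta> e) = label S e"
      unfolding \<beta>_def by auto
  qed
  have head: "head T (\<beta> e) = \<alpha> (head S e)" if e: "e \<in> edges S" for e
    using step_forward[OF S e] step_forward[OF T \<beta>(1)[OF e]] \<beta>[OF e] \<alpha>_step SD(5)[OF e] by metis
  have b: "bij_betw \<beta> (edges S) (edges T)"
    unfolding bij_betw_def
  proof
    show "inj_on \<beta> (edges S)"
    proof (rule inj_onI)
      fix e e' assume ee: "e \<in> edges S" "e' \<in> edges S" "\<beta> e = \<beta> e'"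
      then have "\<alpha> (tail S e) = \<alpha> (tail S e')" "label S e = label S e'" using \<beta> by metis+
      moreover from this have "tail S e = tail S e'"
        using a SD(5) ee by (metis bij_betw_inv_into_left)
      ultimately show "e = e'" using SD(5,6) ee by metis
    qed
    show "\<beta> ` edges S = edges T"
    proof
      show "\<beta> ` edges S \<subseteq> edges T" using \<beta> by auto
      show "edges T \<subseteq> \<beta> ` edges S"
      proof
        fix f assume f: "f \<in> edges T"
        obtain v where v: "v \<in> verts S" "\<alpha> v = tail T f"
          using bij_betw_imp_surj_on[OF a] TD(5)[OF f] by (metis imageE)
        obtain e where e: "e \<in> edges S" "tail S e = v" "label S e = label T f"
          using SD(6)[OF v(1), of "label T f"] TD(5)[OF f] by auto
        have "\<beta> e = f" using \<beta>[OF e(1)] e v f TD(5,6) by metis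
        then show "f \<in> \<beta> ` edges S" using e(1) by auto
      qed
    qed
  qed
  have "labelled_iso_map \<alpha> \<beta> S T"
    unfolding labelled_iso_map_def graph_iso_map_def
    using a b \<beta> head SD(3) TD(3) by (auto simp: directed_ends_def)
  moreover have "\<alpha> (base S) = base T" using \<alpha>[of "[]"] by simp
  ultimately show ?thesis unfolding labelled_rooted_iso_def by blast
qed

section \<open>Classes of Schreier graphs\<close>

text \<open>The point of \<open>Lam m\<close> given by a Schreier graph whose vertices and edges need not be numbers.\<close>

definition labelled_class :: "nat \<Rightarrow> ('v, 'e, 'z) lgraph_scheme \<Rightarrow> (nat, nat) lgraph set" where
  "labelled_class m S = {T. schreier_graph m T \<and> labelled_rooted_iso S T}"

definition countable_graph :: "('v, 'e, 'z) rgraph_scheme \<Rightarrow> bool" where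
  "countable_graph G \<longleftrightarrow> countable (verts G) \<and> countable (edges G)"

lemma countable_graph_nat [simp]: "countable_graph (G :: (nat, nat, 'z) rgraph_scheme)"
  by (simp add: countable_graph_def)

lemma schreier_iso_sym: "schreier_graph m S \<Longrightarrow> labelled_rooted_iso S T \<Longrightarrow> labelled_rooted_iso T S"
  using labelled_rooted_iso_sym schreier_graphD by metis

lemma labelled_class_eqI:
  assumes "schreier_graph m S" "labelled_rooted_iso S T"
  shows "labelled_class m S = labelled_class m T"
proof -
  have "labelled_rooted_iso S U \<longleftrightarrow> labelled_rooted_iso T U" for U :: "(nat, nat) lgraph"
    using labelled_rooted_iso_trans[OF schreier_iso_sym[OF assms]] labelled_rooted_iso_trans[OF assms(2)]
    by blast
  then show ?thesis by (simp add: labelled_class_def)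
qed

lemma nat_copy_in_labelled_class:
  assumes "schreier_graph m S" "countable_graph S"
  obtains T where "schreier_graph m T" "T \<in> labelled_class m S" "labelled_rooted_iso S T"
  using schreier_graph_nat_copy[OF assms(1)] assms(2)
  unfolding labelled_class_def countable_graph_def by blast

lemma Lam_eq: "Lam m = labelled_class m ` {S :: (nat, nat) lgraph. schreier_graph m S}"
  unfolding Lam_def quotient_def labelled_class_def by auto

lemma labelled_class_in_Lam:
  assumes "schreier_graph m S" "countable_graph S"
  shows "labelled_class m S \<in> Lam m"
proof -
  obtain T where "schreier_graph m T" "T \<in> labelled_class m S" "labelled_rooted_iso S T"
    using nat_copy_in_labelled_class[OF assms] .
  then show ?thesis using labelled_class_eqI[OF assms(1), of T] unfolding Lam_eq by auto
qed

lemma Lam_cases: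
  assumes "C \<in> Lam m"
  obtains S where "schreier_graph m S" "C = labelled_class m S" "S \<in> C"
proof -
  obtain S :: "(nat, nat) lgraph" where S: "schreier_graph m S" "C = labelled_class m S"
    using assms unfolding Lam_eq by auto
  then have "S \<in> C" using labelled_rooted_iso_refl by (simp add: labelled_class_def)
  then show ?thesis using that S by blast
qed

lemma labelled_classD: "T \<in> labelled_class m S \<Longrightarrow> schreier_graph m T \<and> labelled_rooted_iso S T"
  by (simp add: labelled_class_def)

definition class_closed_walk :: "(nat, nat) lgraph set \<Rightarrow> (nat \<times> bool) list \<Rightarrow> bool" where
  "class_closed_walk C w \<longleftrightarrow> (\<exists>S\<in>C. closed_walk S w)"

lemma class_closed_walk_labelled_class:
  assumes S: "schreier_graph m S" "countable_graph S" and w: "w \<in> words m"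
  shows "class_closed_walk (labelled_class m S) w \<longleftrightarrow> closed_walk S w"
proof
  assume "class_closed_walk (labelled_class m S) w"
  then obtain T where "T \<in> labelled_class m S" "closed_walk T w"
    unfolding class_closed_walk_def by auto
  then show "closed_walk S w"
    using closed_walk_iso[OF S(1) _ _ w, of T] labelled_classD[of T m S] by simp
next
  assume c: "closed_walk S w"
  obtain T where T: "schreier_graph m T" "T \<in> labelled_class m S" "labelled_rooted_iso S T"
    using nat_copy_in_labelled_class[OF S] .
  have "closed_walk T w" using closed_walk_iso[OF S(1) T(1,3) w] c by simp
  then show "class_closed_walk (labelled_class m S) w"
    using T(2) unfolding class_closed_walk_def by (rule bexI)
qed

lemma Lam_eqI:
  assumes "C \<in> Lam m" "D \<in> Lam m"
    and "\<And>w. w \<in> words m \<Longrightarrow> class_closed_walk C w \<longleftrightarrow> class_closed_walk D w"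
  shows "C = D"
proof -
  from assms(1) obtain S :: "(nat, nat) lgraph" where S: "schreier_graph m S" "C = labelled_class m S" by (rule Lam_cases)
  from assms(2) obtain T :: "(nat, nat) lgraph" where T: "schreier_graph m T" "D = labelled_class m T" by (rule Lam_cases)
  have "labelled_rooted_iso S T"
    using assms(3) unfolding S(2) T(2)
    by (intro labelled_rooted_iso_if_closed_walks_eq[OF S(1) T(1)])
      (simp add: class_closed_walk_labelled_class[OF S(1)] class_closed_walk_labelled_class[OF T(1)])
  then show ?thesis using labelled_class_eqI[OF S(1)] S T by simp
qed

lemma labelled_unrooted_iso_sym:
  assumes "schreier_graph m S" "labelled_unrooted_iso S T"
  shows "labelled_unrooted_iso T S"
  using assms labelled_iso_map_inv[OF _ schreier_graphD(1,3)[OF assms(1)]]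
  unfolding labelled_unrooted_iso_def by metis

lemma labelled_unrooted_iso_trans:
  "labelled_unrooted_iso S T \<Longrightarrow> labelled_unrooted_iso T U \<Longrightarrow> labelled_unrooted_iso S U"
  unfolding labelled_unrooted_iso_def by (metis labelled_iso_map_comp)

lemma labelled_rooted_imp_unrooted_iso: "labelled_rooted_iso S T \<Longrightarrow> labelled_unrooted_iso S T"
  unfolding labelled_rooted_iso_def labelled_unrooted_iso_def by blast

lemma schreier_rel_sym:
  assumes "(C, D) \<in> schreier_rel m"
  shows "(D, C) \<in> schreier_rel m"
proof -
  obtain S T where ST: "C \<in> Lam m" "D \<in> Lam m" "S \<in> C" "T \<in> D" "labelled_unrooted_iso S T"
    using assms by (auto simp: schreier_rel_def)
  have "schreier_graph m S"
    using ST(1,3) labelled_classD by (metis Lam_cases)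
  then show ?thesis
    using ST labelled_unrooted_iso_sym[of m S T] unfolding schreier_rel_def by blast
qed

section \<open>Topology of the spaces of rooted graphs\<close>

lemma labelled_class_in_cylinder_iff:
  assumes S: "schreier_graph m S" "countable_graph S"
  shows "labelled_class m S \<in> cylinder_Lam m r U \<longleftrightarrow> labelled_rooted_iso (nbhd r S) U"
proof
  assume "labelled_class m S \<in> cylinder_Lam m r U"
  then obtain T where T: "T \<in> labelled_class m S" "labelled_rooted_iso (nbhd r T) U"
    unfolding cylinder_Lam_def by auto
  then have "labelled_rooted_iso S T" using labelled_classD[OF T(1)] by simp
  then have "labelled_rooted_iso (nbhd r S) (nbhd r T)"
    by (rule labelled_rooted_iso_nbhd[OF _ schreier_graphD(1,2)[OF S(1)]])
  then show "labelled_rooted_iso (nbhd r S) U"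
    using T(2) by (rule labelled_rooted_iso_trans)
next
  assume U: "labelled_rooted_iso (nbhd r S) U"
  obtain T where T: "schreier_graph m T" "T \<in> labelled_class m S" "labelled_rooted_iso S T"
    using nat_copy_in_labelled_class[OF S] .
  then have "labelled_rooted_iso (nbhd r T) (nbhd r S)"
    by (intro labelled_rooted_iso_nbhd[OF schreier_iso_sym[OF S(1) T(3)] schreier_graphD(1,2)[OF T(1)]])
  then have "labelled_rooted_iso (nbhd r T) U"
    using U by (rule labelled_rooted_iso_trans)
  then show "labelled_class m S \<in> cylinder_Lam m r U"
    using T(2) labelled_class_in_Lam[OF S] unfolding cylinder_Lam_def by auto
qed

lemma topspace_topology_Lam: "topspace (topology_Lam m) = Lam m"
proof -
  have "C \<in> \<Union>{cylinder_Lam m r U |r U. True}" if C: "C \<in> Lam m" for C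
  proof -
    obtain S where "S \<in> C" using C by (rule Lam_cases)
    then have "C \<in> cylinder_Lam m 0 (nbhd 0 S)"
      using C labelled_rooted_iso_refl[of "nbhd 0 S"] unfolding cylinder_Lam_def by blast
    then show ?thesis by blast
  qed
  then have "\<Union>{cylinder_Lam m r U |r U. True} = Lam m"
    unfolding cylinder_Lam_def by blast
  then show ?thesis
    unfolding topology_Lam_def topology_generated_by_topspace .
qed

text \<open>The graphs with the same \<open>r\<close>-neighbourhood as \<open>S\<close> form a single cylinder, so openness can be
  checked on representatives, with a radius that may depend on \<open>S\<close>.\<close>

lemma openin_topology_LamI:
  assumes sub: "U \<subseteq> Lam m"
    and loc: "\<And>S :: (nat, nat) lgraph. schreier_graph m S \<Longrightarrow> labelled_class m S \<in> U \<Longrightarrow>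
      \<exists>r. \<forall>T :: (nat, nat) lgraph. schreier_graph m T \<longrightarrow> labelled_rooted_iso (nbhd r S) (nbhd r T) \<longrightarrow> labelled_class m T \<in> U"
  shows "openin (topology_Lam m) U"
proof (subst openin_subopen, intro ballI)
  fix C assume C: "C \<in> U"
  have "C \<in> Lam m" using C sub by blast
  then obtain S :: "(nat, nat) lgraph" where S: "schreier_graph m S" "C = labelled_class m S" by (rule Lam_cases)
  obtain r where r: "\<And>T :: (nat, nat) lgraph. schreier_graph m T \<Longrightarrow> labelled_rooted_iso (nbhd r S) (nbhd r T) \<Longrightarrow>
      labelled_class m T \<in> U"
    using loc[OF S(1)] C S(2) by blast
  have "cylinder_Lam m r (nbhd r S) \<subseteq> U"
  proof
    fix D assume D: "D \<in> cylinder_Lam m r (nbhd r S)"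
    then have "D \<in> Lam m" by (simp add: cylinder_Lam_def)
    then obtain T :: "(nat, nat) lgraph" where T: "schreier_graph m T" "D = labelled_class m T" by (rule Lam_cases)
    then have "labelled_rooted_iso (nbhd r T) (nbhd r S)"
      using D labelled_class_in_cylinder_iff[OF T(1)] by simp
    then have "labelled_rooted_iso (nbhd r S) (nbhd r T)"
      by (rule labelled_rooted_iso_nbhd_sym[OF _ schreier_graphD(3)[OF T(1)]])
    then show "D \<in> U" using r T by blast
  qed
  moreover have "C \<in> cylinder_Lam m r (nbhd r S)"
    unfolding S(2) by (simp add: labelled_class_in_cylinder_iff[OF S(1)] labelled_rooted_iso_refl)
  moreover have "openin (topology_Lam m) (cylinder_Lam m r (nbhd r S))"
    unfolding topology_Lam_def by (rule topology_generated_by_Basis) blast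
  ultimately show "\<exists>V. openin (topology_Lam m) V \<and> C \<in> V \<and> V \<subseteq> U" by blast
qed

lemma openin_closed_walk:
  assumes w: "w \<in> words m"
  shows "openin (topology_Lam m) {C \<in> Lam m. class_closed_walk C w = b}"
proof (rule openin_topology_LamI)
  fix S :: "(nat, nat) lgraph"
  assume S: "schreier_graph m S" and "labelled_class m S \<in> {C \<in> Lam m. class_closed_walk C w = b}"
  then have b: "closed_walk S w = b"
    using class_closed_walk_labelled_class[OF S _ w] by simp
  show "\<exists>r. \<forall>T :: (nat, nat) lgraph. schreier_graph m T \<longrightarrow> labelled_rooted_iso (nbhd r S) (nbhd r T) \<longrightarrow>
      labelled_class m T \<in> {C \<in> Lam m. class_closed_walk C w = b}"
    using closed_walk_nbhd_iso[OF S _ _ w order_refl] b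
    by (intro exI[of _ "length w"]) (auto simp: class_closed_walk_labelled_class[OF _ _ w] labelled_class_in_Lam)
qed auto

lemma rooted_iso_truncate: "rooted_iso G (rgraph.truncate G)"
  unfolding rooted_iso_def graph_iso_map_def
  by (rule exI[of _ id], rule exI[of _ id]) (simp add: uprod.map_id rgraph.truncate_def)

lemma conn_rooted_regular_truncate: "conn_rooted_regular d G \<Longrightarrow> conn_rooted_regular d (rgraph.truncate G)"
  unfolding conn_rooted_regular_def
  by (simp add: adj_def incident_def degree_def rgraph.truncate_def)

lemma unlabelled_copy:
  assumes S: "schreier_graph m S" "countable_graph S"
  obtains H :: "(nat, nat) rgraph" where "conn_rooted_regular (2 * m) H" "rooted_iso S H"
proof -
  obtain T where T: "schreier_graph m T" "T \<in> labelled_class m S" "labelled_rooted_iso S T"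
    using nat_copy_in_labelled_class[OF S] .
  have "conn_rooted_regular (2 * m) T" using T(1) by (simp add: schreier_graph_def)
  then show ?thesis
    by (rule that[OF conn_rooted_regular_truncate])
      (rule rooted_iso_trans[OF labelled_rooted_iso_imp_rooted_iso[OF T(3)] rooted_iso_truncate])
qed

lemma rooted_iso_sym_regular:
  "conn_rooted_regular d G \<Longrightarrow> rooted_iso G H \<Longrightarrow> rooted_iso H G"
  by (rule rooted_iso_sym[OF _ conn_rooted_regularD(1,2)])

lemma unlabelled_class_eqI:
  assumes "conn_rooted_regular d G" "rooted_iso G H"
  shows "unlabelled_class m G = unlabelled_class m H"
proof -
  have "rooted_iso G K \<longleftrightarrow> rooted_iso H K" for K :: "(nat, nat) rgraph"
    using rooted_iso_trans[OF rooted_iso_sym_regular[OF assms]] rooted_iso_trans[OF assms(2)] by blast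
  then show ?thesis by (simp add: unlabelled_class_def)
qed

lemma unlabelled_class_in_Omega:
  assumes S: "schreier_graph m S" "countable_graph S"
  shows "unlabelled_class m S \<in> Omega m"
proof -
  obtain H :: "(nat, nat) rgraph" where H: "conn_rooted_regular (2 * m) H" "rooted_iso S H"
    using unlabelled_copy[OF S] .
  have "unlabelled_class m S = unlabelled_class m H"
    using S(1) H(2) unfolding schreier_graph_def by (intro unlabelled_class_eqI[of "2 * m"]) auto
  also have "\<dots> \<in> Omega m"
    using H(1) unfolding Omega_def quotient_def unlabelled_class_def by auto
  finally show ?thesis .
qed

lemma unlabelled_class_in_cylinder_iff:
  assumes S: "schreier_graph m S" "countable_graph S"
  shows "unlabelled_class m S \<in> cylinder_Omega m r U \<longleftrightarrow> rooted_iso (nbhd r S) U"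
proof
  assume "unlabelled_class m S \<in> cylinder_Omega m r U"
  then obtain H :: "(nat, nat) rgraph" where H: "rooted_iso S H" "rooted_iso (nbhd r H) U"
    unfolding cylinder_Omega_def unlabelled_class_def by auto
  then show "rooted_iso (nbhd r S) U"
    by (intro rooted_iso_trans[OF rooted_iso_nbhd[OF H(1) schreier_graphD(1,2)[OF S(1)]] H(2)])
next
  assume U: "rooted_iso (nbhd r S) U"
  obtain H :: "(nat, nat) rgraph" where H: "conn_rooted_regular (2 * m) H" "rooted_iso S H"
    using unlabelled_copy[OF S] .
  have "rooted_iso H S"
    using S(1) H(2) unfolding schreier_graph_def by (auto intro: rooted_iso_sym_regular[of "2 * m" S H])
  then have "rooted_iso (nbhd r H) U"
    by (rule rooted_iso_trans[OF rooted_iso_nbhd[OF _ conn_rooted_regularD(1,2)[OF H(1)]] U])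
  then show "unlabelled_class m S \<in> cylinder_Omega m r U"
    using H unlabelled_class_in_Omega[OF S] unfolding cylinder_Omega_def
    by (auto simp: unlabelled_class_def)
qed

lemma topspace_topology_Omega: "topspace (topology_Omega m) = Omega m"
proof -
  have "C \<in> \<Union>{cylinder_Omega m r U |r U. True}" if C: "C \<in> Omega m" for C
  proof -
    obtain G where "G \<in> C"
      using C rooted_iso_refl unfolding Omega_def quotient_def by blast
    then have "C \<in> cylinder_Omega m 0 (nbhd 0 G)"
      using C rooted_iso_refl unfolding cylinder_Omega_def by blast
    then show ?thesis by blast
  qed
  then have "\<Union>{cylinder_Omega m r U |r U. True} = Omega m"
    unfolding cylinder_Omega_def by blast
  then show ?thesis
    unfolding topology_Omega_def topology_generated_by_topspace .
qed

lemma forget_labelled_class: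
  assumes S: "schreier_graph m S" "countable_graph S"
  shows "forget m (labelled_class m S) = unlabelled_class m S"
proof -
  have "unlabelled_class m T = unlabelled_class m S" if "T \<in> labelled_class m S" for T
    using labelled_classD[OF that] S(1) labelled_rooted_iso_imp_rooted_iso[of S T]
      unlabelled_class_eqI[of "2 * m" S T m] unfolding schreier_graph_def by simp
  moreover have "labelled_class m S \<noteq> {}"
    using nat_copy_in_labelled_class[OF S] by blast
  ultimately show ?thesis unfolding forget_def by auto
qed

lemma continuous_map_forget: "continuous_map (topology_Lam m) (topology_Omega m) (forget m)"
  unfolding topology_Omega_def
proof (rule continuous_on_generated_topo)
  fix V assume "V \<in> {cylinder_Omega m r U |r U. True}"
  then obtain r U where V: "V = cylinder_Omega m r U" by auto
  have iff: "labelled_class m S \<in> forget m -` V \<inter> Lam m \<longleftrightarrow> rooted_iso (nbhd r S) U"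
    if "schreier_graph m S" for S :: "(nat, nat) lgraph"
    using forget_labelled_class[OF that] unlabelled_class_in_cylinder_iff[OF that]
      labelled_class_in_Lam[OF that] V by simp
  show "openin (topology_Lam m) (forget m -` V \<inter> topspace (topology_Lam m))"
    unfolding topspace_topology_Lam
  proof (rule openin_topology_LamI)
    fix S :: "(nat, nat) lgraph"
    assume S: "schreier_graph m S" "labelled_class m S \<in> forget m -` V \<inter> Lam m"
    have "labelled_class m T \<in> forget m -` V \<inter> Lam m"
      if T: "schreier_graph m T" "labelled_rooted_iso (nbhd r S) (nbhd r T)" for T :: "(nat, nat) lgraph"
    proof -
      have "labelled_rooted_iso (nbhd r T) (nbhd r S)"
        by (rule labelled_rooted_iso_nbhd_sym[OF T(2) schreier_graphD(3)[OF S(1)]])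
      then show ?thesis
        using iff[OF S(1)] iff[OF T(1)] S(2)
          rooted_iso_trans[OF labelled_rooted_iso_imp_rooted_iso, of "nbhd r T" "nbhd r S" U] by simp
    qed
    then show "\<exists>r. \<forall>T :: (nat, nat) lgraph. schreier_graph m T \<longrightarrow> labelled_rooted_iso (nbhd r S) (nbhd r T) \<longrightarrow>
       labelled_class m T \<in> forget m -` V \<inter> Lam m" by blast
  qed auto
next
  have "forget m C \<in> Omega m" if "C \<in> Lam m" for C
    by (rule Lam_cases[OF that]) (simp add: forget_labelled_class unlabelled_class_in_Omega)
  then show "forget m ` topspace (topology_Lam m) \<subseteq> \<Union>{cylinder_Omega m r U |r U. True}"
    using topspace_topology_Omega[of m] unfolding topology_Omega_def topology_generated_by_topspace
      topspace_topology_Lam by blast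
qed

section \<open>Borel structure\<close>

lemma space_borel_of_topology [simp]: "space (borel_of_topology X) = topspace X"
  unfolding borel_of_topology_def by (rule space_measure_of) (auto dest: openin_subset)

lemma sets_borel_of_topology: "sets (borel_of_topology X) = sigma_sets (topspace X) {U. openin X U}"
  unfolding borel_of_topology_def by (rule sets_measure_of) (auto dest: openin_subset)

lemma openin_in_sets_borel: "openin X U \<Longrightarrow> U \<in> sets (borel_of_topology X)"
  unfolding sets_borel_of_topology by (rule sigma_sets.Basic) simp

lemma measurable_borel_of_topologyI:
  assumes "f \<in> space M \<rightarrow> topspace Y" "\<And>U. openin Y U \<Longrightarrow> f -` U \<inter> space M \<in> sets M"
  shows "f \<in> measurable M (borel_of_topology Y)"
  unfolding borel_of_topology_def using assms
  by (intro measurable_measure_of) (auto dest: openin_subset)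

lemma continuous_map_measurable_borel:
  assumes "continuous_map X Y f"
  shows "f \<in> measurable (borel_of_topology X) (borel_of_topology Y)"
  using assms by (intro measurable_borel_of_topologyI)
    (auto simp: continuous_map_alt continuous_map_def intro: openin_in_sets_borel)

text \<open>The diagonal of \<open>Lam m\<close> is measurable, since points are separated by the countably many clopen
  sets that say whether a given word is closed.\<close>

lemma sets_Lam_eq:
  assumes f: "f \<in> measurable M (borel_of_topology (topology_Lam m))"
    and g: "g \<in> measurable M (borel_of_topology (topology_Lam m))"
  shows "{x \<in> space M. f x = g x} \<in> sets M"
proof -
  have sp: "f x \<in> Lam m" "g x \<in> Lam m" if "x \<in> space M" for x
    using measurable_space[OF f that] measurable_space[OF g that] by (simp_all add: topspace_topology_Lam)
  have "{x \<in> space M. class_closed_walk (h x) w = b} \<in> sets M"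
    if w: "w \<in> words m" and h: "h \<in> measurable M (borel_of_topology (topology_Lam m))" for w b h
  proof -
    have "{x \<in> space M. class_closed_walk (h x) w = b} = h -` {C \<in> Lam m. class_closed_walk C w = b} \<inter> space M"
      using measurable_space[OF h] by (auto simp: topspace_topology_Lam)
    then show ?thesis
      using measurable_sets[OF h openin_in_sets_borel[OF openin_closed_walk[OF w]]] by simp
  qed
  note * = this
  have "{x \<in> space M. f x = g x} = (\<Inter>w\<in>words m. {x \<in> space M. class_closed_walk (f x) w = class_closed_walk (g x) w})"
    (is "?L = ?R")
  proof
    show "?R \<subseteq> ?L"
    proof
      fix x assume x: "x \<in> ?R"
      then have "x \<in> space M" using words_simps(1)[of m] by blast
      moreover have "f x = g x"
        using x by (intro Lam_eqI[OF sp[OF \<open>x \<in> space M\<close>]]) auto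
      ultimately show "x \<in> ?L" by simp
    qed
  qed auto
  also have "\<dots> \<in> sets M"
  proof (rule sets.countable_INT'[OF countable_words])
    show "words m \<noteq> {}" using words_simps(1) by blast
    have "{x \<in> space M. class_closed_walk (f x) w = class_closed_walk (g x) w} \<in> sets M" if w: "w \<in> words m" for w
    proof -
      have "{x \<in> space M. class_closed_walk (f x) w = class_closed_walk (g x) w} =
          ({x \<in> space M. class_closed_walk (f x) w = True} \<inter> {x \<in> space M. class_closed_walk (g x) w = True}) \<union>
          ({x \<in> space M. class_closed_walk (f x) w = False} \<inter> {x \<in> space M. class_closed_walk (g x) w = False})"
        by auto
      then show ?thesis using *[OF w f] *[OF w g] by (simp only: sets.Int sets.Un)
    qed
    then show "(\<lambda>w. {x \<in> space M. class_closed_walk (f x) w = class_closed_walk (g x) w}) ` words m \<subseteq> sets M"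
      by auto
  qed
  finally show ?thesis .
qed

section \<open>Cyclic subgroups of infinite index\<close>

context group
begin

abbreviation left_cosets :: "'a set \<Rightarrow> 'a set set" where
  "left_cosets H \<equiv> (\<lambda>x. x <# H) ` carrier G"

lemma l_coset_eq_iff:
  assumes "subgroup H G" "x \<in> carrier G" "y \<in> carrier G"
  shows "x <# H = y <# H \<longleftrightarrow> inv x \<otimes> y \<in> H"
proof -
  interpret H: subgroup H G by fact
  have sub: "y <# H \<subseteq> x <# H" if x: "x \<in> carrier G" and y: "y \<in> carrier G" and h: "inv x \<otimes> y \<in> H" for x y
  proof
    fix z assume "z \<in> y <# H"
    then obtain k where k: "k \<in> H" "z = y \<otimes> k" by (auto simp: l_coset_def)
    have "z = x \<otimes> ((inv x \<otimes> y) \<otimes> k)" using k x y by (simp add: m_assoc[symmetric])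
    then show "z \<in> x <# H" using H.m_closed[OF h k(1)] by (auto simp: l_coset_def)
  qed
  show ?thesis
  proof
    assume "x <# H = y <# H"
    moreover have "y \<in> y <# H" using assms(3) H.one_closed by (force simp: l_coset_def)
    ultimately obtain k where "k \<in> H" "y = x \<otimes> k" by (auto simp: l_coset_def)
    then show "inv x \<otimes> y \<in> H" using assms by (simp add: m_assoc[symmetric])
  next
    assume h: "inv x \<otimes> y \<in> H"
    have "inv y \<otimes> x = inv (inv x \<otimes> y)" using assms by (simp add: inv_mult_group)
    then have "inv y \<otimes> x \<in> H" using h by simp
    then show "x <# H = y <# H" using sub h assms by blast
  qed
qed

lemma subgroup_generate_singleton: "a \<in> carrier G \<Longrightarrow> subgroup (generate G {a}) G"
  by (rule generate_is_subgroup) simp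

text \<open>Among infinitely many powers of \<open>b\<close>, two lie in the same coset of \<open>H\<close>.\<close>

lemma ex_power_in_subgroup:
  assumes H: "subgroup H G" "finite (left_cosets H)" and b: "b \<in> carrier G"
  shows "\<exists>n>0. b [^] (n::nat) \<in> H"
proof -
  have "\<not> inj_on (\<lambda>n::nat. b [^] n <# H) UNIV"
  proof
    assume "inj_on (\<lambda>n::nat. b [^] n <# H) UNIV"
    moreover have "finite (range (\<lambda>n::nat. b [^] n <# H))"
      using b by (intro finite_subset[OF _ H(2)]) auto
    ultimately show False using finite_imageD infinite_UNIV_nat by blast
  qed
  then obtain i j :: nat where "i < j" "b [^] i <# H = b [^] j <# H"
    unfolding inj_on_def by (metis linorder_neqE_nat)
  moreover from this have "inv (b [^] i) \<otimes> b [^] j = b [^] (j - i)"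
    using b nat_pow_mult[OF b, of i "j - i", symmetric] by (simp add: m_assoc[symmetric])
  ultimately show ?thesis
    using l_coset_eq_iff[OF H(1), of "b [^] i" "b [^] j"] b by (intro exI[of _ "j - i"]) auto
qed

lemma torsion_free_if_finite_index:
  assumes inf: "infinite (carrier G)" and a: "a \<in> carrier G"
    and fin: "finite (left_cosets (generate G {a}))" and k: "a [^] (k::int) = \<one>"
  shows "k = 0"
proof (rule ccontr)
  assume "k \<noteq> 0"
  then have "finite (generate G {a})"
    using k a finite_cyclic_subgroup_int[OF a] by (auto simp: carrier_subgroup_generated)
  then have "finite (\<Union>(left_cosets (generate G {a})))"
    using fin by (auto simp: l_coset_def)
  moreover have "carrier G \<subseteq> \<Union>(left_cosets (generate G {a}))"
  proof
    fix x assume x: "x \<in> carrier G"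
    have "x \<in> x <# generate G {a}" using x generate.one[of G "{a}"] by (force simp: l_coset_def)
    then show "x \<in> \<Union>(left_cosets (generate G {a}))" using x by auto
  qed
  ultimately show False using inf finite_subset by blast
qed

lemma countable_generate:
  assumes "A \<subseteq> carrier G" "countable A"
  shows "countable (generate G A)"
proof -
  define val where "val l = (if snd l then fst l else inv (fst l))" for l :: "'a \<times> bool"
  define ev where "ev l = foldr (\<lambda>p x. val p \<otimes> x) l \<one>" for l
  have val: "val p \<in> carrier G" if "p \<in> A \<times> UNIV" for p
    using that assms(1) by (auto simp: val_def)
  have ev: "ev l \<in> carrier G" if "l \<in> lists (A \<times> UNIV)" for l
    using that val by (induction l) (auto simp: ev_def)
  have app: "ev (k @ l) = ev k \<otimes> ev l" if "k \<in> lists (A \<times> UNIV)" "l \<in> lists (A \<times> UNIV)" for k l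
    using that
  proof (induction k)
    case Nil
    then show ?case using ev[of l] by (simp add: ev_def)
  next
    case (Cons p k)
    then show ?case using ev[of k] ev[of l] val[of p] by (simp add: ev_def m_assoc)
  qed
  have "\<exists>l\<in>lists (A \<times> UNIV). g = ev l" if "g \<in> generate G A" for g
    using that
  proof induction
    case one
    show ?case by (intro bexI[of _ "[]"]) (auto simp: ev_def)
  next
    case (incl h)
    then show ?case using assms(1) by (intro bexI[of _ "[(h, True)]"]) (auto simp: ev_def val_def)
  next
    case (inv h)
    then show ?case using assms(1) by (intro bexI[of _ "[(h, False)]"]) (auto simp: ev_def val_def)
  next
    case (eng h1 h2)
    then obtain k l where "k \<in> lists (A \<times> UNIV)" "l \<in> lists (A \<times> UNIV)" "h1 = ev k" "h2 = ev l" by auto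
    then show ?case using app by (intro bexI[of _ "k @ l"]) auto
  qed
  then have "generate G A \<subseteq> ev ` lists (A \<times> UNIV)" by auto
  moreover have "countable (ev ` lists (A \<times> (UNIV :: bool set)))"
    using assms(2) by (intro countable_image countable_lists countable_SIGMA) auto
  ultimately show ?thesis by (rule countable_subset)
qed

lemma commutes_inv:
  assumes "x \<in> carrier G" "y \<in> carrier G" "x \<otimes> y = y \<otimes> x"
  shows "inv x \<otimes> y = y \<otimes> inv x"
proof -
  have "inv x \<otimes> y = inv x \<otimes> (y \<otimes> x) \<otimes> inv x" using assms(1,2) by (simp add: m_assoc)
  also have "\<dots> = inv x \<otimes> (x \<otimes> y) \<otimes> inv x" using assms(3) by simp
  also have "\<dots> = y \<otimes> inv x" using assms(1,2) by (simp add: m_assoc[symmetric])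
  finally show ?thesis .
qed

lemma commutes_int_pow:
  assumes "x \<in> carrier G" "y \<in> carrier G" "x \<otimes> y = y \<otimes> x"
  shows "x [^] (k::int) \<otimes> y = y \<otimes> x [^] k"
proof (cases "k < 0")
  case True
  have "x [^] nat (- k) \<otimes> y = y \<otimes> x [^] nat (- k)"
    by (rule group_commutes_pow[OF assms(3,1,2)])
  then have "inv (x [^] nat (- k)) \<otimes> y = y \<otimes> inv (x [^] nat (- k))"
    by (rule commutes_inv[OF nat_pow_closed[OF assms(1)] assms(2)])
  then show ?thesis unfolding int_pow_def2 using True by metis
next
  case False
  have "x [^] nat k \<otimes> y = y \<otimes> x [^] nat k"
    by (rule group_commutes_pow[OF assms(3,1,2)])
  then show ?thesis unfolding int_pow_def2 using False by metis
qed

text \<open>Each generator \<open>b\<close> commutes with those powers of \<open>a\<close> that lie in the subgroup generated by \<open>b\<close>,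
  and a common multiple of finitely many exponents serves all generators at once.\<close>

lemma ex_central_power:
  assumes A: "finite A" "A \<subseteq> carrier G" "generate G A = carrier G" and a: "a \<in> carrier G"
    and fin: "\<And>b. b \<in> carrier G \<Longrightarrow> b \<noteq> \<one> \<Longrightarrow> finite (left_cosets (generate G {b}))"
  shows "\<exists>n>0. \<forall>g\<in>carrier G. a [^] (n::nat) \<otimes> g = g \<otimes> a [^] n"
proof -
  have "\<exists>n>0. a [^] (n::nat) \<otimes> b = b \<otimes> a [^] n" if b: "b \<in> A" for b
  proof (cases "b = \<one>")
    case True
    then show ?thesis using a by (intro exI[of _ 1]) auto
  next
    case False
    have bc: "b \<in> carrier G" using b A by auto
    obtain n where n: "n > 0" "a [^] (n::nat) \<in> generate G {b}"
      using ex_power_in_subgroup[OF subgroup_generate_singleton fin a] bc False by blast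
    then obtain k :: int where k: "a [^] n = b [^] k" using generate_pow[OF bc] by auto
    have "b [^] k \<otimes> b = b [^] (k + 1)" "b \<otimes> b [^] k = b [^] (1 + k)"
      using bc by (simp_all add: int_pow_mult)
    then show ?thesis using n k by (intro exI[of _ n]) (simp add: add.commute)
  qed
  then obtain n where n: "\<And>b. b \<in> A \<Longrightarrow> n b > 0" "\<And>b. b \<in> A \<Longrightarrow> a [^] (n b :: nat) \<otimes> b = b \<otimes> a [^] n b"
    by metis
  define N where "N = (\<Prod>b\<in>A. n b)"
  define C where "C = {g \<in> carrier G. a [^] N \<otimes> g = g \<otimes> a [^] N}"
  have "subgroup C G"
  proof
    show "C \<subseteq> carrier G" by (auto simp: C_def)
    show "x \<otimes> y \<in> C" if "x \<in> C" "y \<in> C" for x y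
      using that a unfolding C_def by (auto simp: m_assoc) (metis m_assoc nat_pow_closed)
    show "\<one> \<in> C" using a by (simp add: C_def)
    show "inv x \<in> C" if x: "x \<in> C" for x
      using x a commutes_inv[of x "a [^] N"] by (simp add: C_def)
  qed
  moreover have "A \<subseteq> C"
  proof
    fix b assume b: "b \<in> A"
    then have bc: "b \<in> carrier G" using A by auto
    obtain q where q: "N = n b * q" using dvd_prodI[OF A(1) b, of n] unfolding N_def by (auto elim: dvdE)
    have *: "a [^] n b \<otimes> b = b \<otimes> a [^] n b" using n b by auto
    have "(a [^] n b) [^] q \<otimes> b = b \<otimes> (a [^] n b) [^] q"
      by (rule group_commutes_pow[OF *]) (use a bc in auto)
    then show "b \<in> C" using bc a q by (simp add: C_def nat_pow_pow)
  qed
  ultimately have "carrier G \<subseteq> C" using generate_subgroup_incl A(3) by blast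
  moreover have "N > 0" using n(1) A(1) by (auto simp: N_def prod_pos)
  ultimately show ?thesis unfolding C_def by (intro exI[of _ N]) auto
qed

text \<open>This is the transfer. Multiplying the representative of a coset \<open>C\<close> by \<open>g\<close> gives the
  representative of another coset times a power \<open>z [^] \<kappa> g C\<close>. The exponents satisfy the cocycle
  identity \<open>\<kappa> (g \<otimes> h) C = \<kappa> g (h <# C) + \<kappa> h C\<close>, and as \<open>h\<close> permutes the cosets, the sum of \<open>\<kappa> g C\<close>
  over all cosets \<open>C\<close> is additive in \<open>g\<close>.\<close>

lemma transfer_to_central_cyclic:
  assumes z: "z \<in> carrier G" and central: "\<And>g. g \<in> carrier G \<Longrightarrow> z \<otimes> g = g \<otimes> z"
    and fin: "finite (left_cosets (generate G {z}))"
    and inf: "\<And>k::int. z [^] k = \<one> \<Longrightarrow> k = 0"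
  obtains V where "V \<in> hom G integer_group"
    "\<And>k::int. V (z [^] k) = k * int (card (left_cosets (generate G {z})))"
proof -
  define H where "H = generate G {z}"
  define Q where "Q = left_cosets H"
  have H: "subgroup H G" unfolding H_def by (rule subgroup_generate_singleton[OF z])
  have H_eq: "H = range (\<lambda>k::int. z [^] k)"
    unfolding H_def using generate_pow[OF z] by auto
  have zinj: "k = l" if "z [^] k = z [^] l" for k l :: int
    using inf[of "k - l"] int_pow_diff[OF z, of k l] that z by simp
  define rep where "rep C = (SOME x. x \<in> carrier G \<and> x <# H = C)" for C
  have rep: "rep C \<in> carrier G" "rep C <# H = C" if "C \<in> Q" for C
  proof -
    have "\<exists>x. x \<in> carrier G \<and> x <# H = C" using that by (auto simp: Q_def)
    from someI_ex[OF this] show "rep C \<in> carrier G" "rep C <# H = C" unfolding rep_def by auto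
  qed
  define act where "act g C = (g \<otimes> rep C) <# H" for g C
  have act_Q: "act g C \<in> Q" if "g \<in> carrier G" "C \<in> Q" for g C
    using that rep by (auto simp: act_def Q_def)
  have ex: "\<exists>k::int. g \<otimes> rep C = rep (act g C) \<otimes> z [^] k" if g: "g \<in> carrier G" and C: "C \<in> Q" for g C
  proof -
    have c: "g \<otimes> rep C \<in> carrier G" "rep (act g C) \<in> carrier G"
      using g C rep act_Q by auto
    have "rep (act g C) <# H = (g \<otimes> rep C) <# H"
      using rep(2)[OF act_Q[OF g C]] by (simp add: act_def)
    then have "inv (rep (act g C)) \<otimes> (g \<otimes> rep C) \<in> H"
      using l_coset_eq_iff[OF H c(2,1)] by simp
    then obtain k :: int where "inv (rep (act g C)) \<otimes> (g \<otimes> rep C) = z [^] k" by (auto simp: H_eq)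
    then have "g \<otimes> rep C = rep (act g C) \<otimes> z [^] k" using c z by (simp add: inv_solve_left')
    then show ?thesis ..
  qed
  define \<kappa> where "\<kappa> g C = (SOME k::int. g \<otimes> rep C = rep (act g C) \<otimes> z [^] k)" for g C
  have \<kappa>: "g \<otimes> rep C = rep (act g C) \<otimes> z [^] \<kappa> g C" if "g \<in> carrier G" "C \<in> Q" for g C
    unfolding \<kappa>_def by (rule someI_ex[OF ex[OF that]])
  have uniq: "act g C = D \<and> \<kappa> g C = k"
    if g: "g \<in> carrier G" and CD: "C \<in> Q" "D \<in> Q" and eq: "g \<otimes> rep C = rep D \<otimes> z [^] k" for g C D k
  proof -
    have "rep D <# H = (g \<otimes> rep C) <# H"
      using l_coset_eq_iff[OF H, of "rep D" "g \<otimes> rep C"] rep CD g z eq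
      by (simp add: H_eq m_assoc[symmetric])
    then have D: "act g C = D" using rep(2)[OF CD(2)] by (simp add: act_def)
    then show ?thesis using \<kappa>[OF g CD(1)] eq rep CD z zinj by simp
  qed
  have comp: "act (g \<otimes> h) C = act g (act h C) \<and> \<kappa> (g \<otimes> h) C = \<kappa> g (act h C) + \<kappa> h C"
    if g: "g \<in> carrier G" and h: "h \<in> carrier G" and C: "C \<in> Q" for g h C
  proof (rule uniq)
    have "g \<otimes> h \<otimes> rep C = g \<otimes> (rep (act h C) \<otimes> z [^] \<kappa> h C)"
      using \<kappa>[OF h C] g h C rep by (simp add: m_assoc)
    also have "\<dots> = rep (act g (act h C)) \<otimes> z [^] \<kappa> g (act h C) \<otimes> z [^] \<kappa> h C"
      using \<kappa>[OF g act_Q[OF h C]] g rep act_Q[OF h C] z by (simp add: m_assoc[symmetric])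
    also have "\<dots> = rep (act g (act h C)) \<otimes> z [^] (\<kappa> g (act h C) + \<kappa> h C)"
      using g h C act_Q rep z by (simp add: m_assoc int_pow_mult)
    finally show "g \<otimes> h \<otimes> rep C = rep (act g (act h C)) \<otimes> z [^] (\<kappa> g (act h C) + \<kappa> h C)" .
  qed (use g h C act_Q in auto)
  have zpow: "act (z [^] k) C = C \<and> \<kappa> (z [^] k) C = k" if C: "C \<in> Q" for k :: int and C
  proof (rule uniq)
    have c: "rep C \<in> carrier G" using rep C by auto
    show "z [^] k \<otimes> rep C = rep C \<otimes> z [^] k"
      by (rule commutes_int_pow[OF z c central[OF c]])
  qed (use C z in auto)
  have bij: "bij_betw (act g) Q Q" if g: "g \<in> carrier G" for g
  proof (rule bij_betw_byWitness[where f' = "act (inv g)"])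
    have "act \<one> C = C" if "C \<in> Q" for C using zpow[OF that, of 0] by simp
    then show "\<forall>C\<in>Q. act (inv g) (act g C) = C" "\<forall>C\<in>Q. act g (act (inv g) C) = C"
      using comp[of "inv g" g] comp[of g "inv g"] g by auto
  qed (use g act_Q in auto)
  define V where "V g = (\<Sum>C\<in>Q. \<kappa> g C)" for g
  have "V (g \<otimes> h) = V g + V h" if g: "g \<in> carrier G" and h: "h \<in> carrier G" for g h
  proof -
    have "V (g \<otimes> h) = (\<Sum>C\<in>Q. \<kappa> g (act h C)) + V h"
      unfolding V_def using comp[OF g h] by (simp add: sum.distrib)
    also have "(\<Sum>C\<in>Q. \<kappa> g (act h C)) = V g"
      unfolding V_def by (rule sum.reindex_bij_betw[OF bij[OF h]])
    finally show ?thesis .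
  qed
  then have "V \<in> hom G integer_group" by (auto simp: hom_def)
  moreover have "V (z [^] k) = k * int (card Q)" for k :: int
    unfolding V_def using zpow by simp
  ultimately show ?thesis using that unfolding Q_def H_def by blast
qed

text \<open>Some positive power of any \<open>g \<noteq> \<one>\<close> is a nontrivial power of the central element \<open>z\<close>, on which the
  transfer does not vanish. So the transfer embeds the group into the integers.\<close>

lemma cyclic_if_cyclic_subgroups_finite_index:
  assumes inf: "infinite (carrier G)"
    and A: "finite A" "A \<subseteq> carrier G" "generate G A = carrier G"
    and fin: "\<And>b. b \<in> carrier G \<Longrightarrow> b \<noteq> \<one> \<Longrightarrow> finite (left_cosets (generate G {b}))"
  shows "cyclic_group G"
proof -
  have tf: "k = 0" if "b \<in> carrier G" "b \<noteq> \<one>" "b [^] (k::int) = \<one>" for b k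
    using torsion_free_if_finite_index[OF inf that(1) fin that(3)] that by blast
  have tf_nat: "k = 0" if "b \<in> carrier G" "b \<noteq> \<one>" "b [^] (k::nat) = \<one>" for b k
    using tf[OF that(1,2), of "int k"] that(3) by (simp add: int_pow_int)
  obtain a where a: "a \<in> carrier G" "a \<noteq> \<one>"
    using inf by (metis finite.simps insertCI subsetI finite_subset one_closed singletonI)
  obtain N :: nat where N: "N > 0" "\<And>g. g \<in> carrier G \<Longrightarrow> a [^] N \<otimes> g = g \<otimes> a [^] N"
    using ex_central_power[OF A a(1) fin] by blast
  define z where "z = a [^] N"
  have z: "z \<in> carrier G" "z \<noteq> \<one>" using a N(1) tf_nat[OF a] by (auto simp: z_def)
  let ?n = "int (card (left_cosets (generate G {z})))"
  obtain V where V: "V \<in> hom G integer_group" "\<And>k::int. V (z [^] k) = k * ?n"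
    using transfer_to_central_cyclic[OF z(1) _ fin[OF z] tf[OF z]] N(2) unfolding z_def by metis
  have npos: "?n > 0" using fin[OF z] one_closed by (auto simp: card_gt_0_iff)
  interpret V: group_hom G integer_group V
    using V(1) by (simp add: group_hom_def group_hom_axioms_def is_group)
  have Vpow: "V (g [^] k) = k * V g" if "g \<in> carrier G" for g and k :: int
    using V.hom_int_pow[OF that, of k] by (simp add: mult.commute)
  have Vinj: "g = \<one>" if g: "g \<in> carrier G" "V g = 0" for g
  proof (rule ccontr)
    assume g1: "g \<noteq> \<one>"
    obtain n where n: "n > 0" "g [^] (n::nat) \<in> generate G {z}"
      using ex_power_in_subgroup[OF subgroup_generate_singleton[OF z(1)] fin[OF z] g(1)] by blast
    then obtain k :: int where k: "g [^] n = z [^] k" using generate_pow[OF z(1)] by auto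
    have "V (g [^] n) = 0" using Vpow[OF g(1), of "int n"] g(2) by (simp add: int_pow_int)
    then have "k = 0" using V(2)[of k] k npos by simp
    then have "g [^] n = \<one>" using k by simp
    then have "n = 0" by (rule tf_nat[OF g(1) g1])
    then show False using n(1) by simp
  qed
  define P where "P n \<longleftrightarrow> n > 0 \<and> (\<exists>g\<in>carrier G. V g = int n)" for n
  have "P (nat ?n)" unfolding P_def using npos V(2)[of 1] z(1) by (auto intro!: bexI[of _ z])
  define d where "d = (LEAST n. P n)"
  have "P d" unfolding d_def by (rule LeastI) fact
  then obtain x where x: "x \<in> carrier G" "V x = int d" and d: "d > 0" by (auto simp: P_def)
  have "g \<in> range (\<lambda>k::int. x [^] k)" if g: "g \<in> carrier G" for g
  proof -
    define q where "q = V g div int d"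
    define h where "h = g \<otimes> x [^] (- q)"
    have h: "h \<in> carrier G" using g x by (simp add: h_def)
    have "V h = V g + V (x [^] (- q))" unfolding h_def using g x(1) by (simp add: V.hom_mult)
    also have "\<dots> = V g mod int d" using Vpow[OF x(1), of "- q"] x(2)
      by (simp add: q_def minus_div_mult_eq_mod[symmetric])
    finally have Vh: "V h = V g mod int d" .
    have "V h = 0"
    proof (rule ccontr)
      assume "V h \<noteq> 0"
      moreover have "V h \<ge> 0" using Vh d by simp
      ultimately have "nat (V h) > 0" "V h = int (nat (V h))" by simp_all
      then have "P (nat (V h))" unfolding P_def using h by metis
      then have "d \<le> nat (V h)" unfolding d_def by (rule Least_le)
      moreover have "V h < int d" using Vh d by simp
      ultimately show False using d by linarith
    qed
    then have "g \<otimes> x [^] (- q) = \<one>" using Vinj[OF h] by (simp add: h_def)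
    then have "g = x [^] q" using g x(1) by (simp add: int_pow_neg inv_equality inv_solve_right')
    then show ?thesis by blast
  qed
  then have "carrier G = range (\<lambda>k::int. x [^] k)" using x(1) by auto
  then show ?thesis using cyclic_group x(1) by blast
qed

end

section \<open>Mass transport\<close>

lemma emeasure_count_space_image:
  assumes "inj_on f A"
  shows "emeasure (count_space UNIV) (f ` A) = emeasure (count_space UNIV) A"
  using assms by (auto simp: emeasure_count_space card_image finite_image_iff)

lemma emeasure_count_space_image_nat:
  fixes f :: "nat \<Rightarrow> 'x"
  assumes "inj_on f K"
  shows "emeasure (count_space UNIV) (f ` K) = (\<Sum>k. indicator K k)"
proof -
  have "emeasure (count_space UNIV) (f ` K) = emeasure (count_space UNIV) K"
    by (rule emeasure_count_space_image[OF assms])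
  also have "\<dots> = (\<integral>\<^sup>+ k. indicator K k \<partial>count_space UNIV)" by simp
  also have "\<dots> = (\<Sum>k. indicator K k)" by (rule nn_integral_count_space_nat)
  finally show ?thesis .
qed

text \<open>Suppose that the orbit of \<open>x\<close> consists of the points \<open>T k x\<close>, where the bijections \<open>T k\<close> with inverse
  \<open>T' k\<close> preserve the measure. The pairs in \<open>F\<close> within orbits can be counted by their first or by their
  second component, with the same total. Since several \<open>k\<close> may lead
  from \<open>x\<close> to the same point, a pair \<open>(x, y)\<close> is attributed to the least \<open>k\<close> with \<open>y = T k x\<close>, and \<open>A k\<close>
  is the set of starting points of the pairs attributed to \<open>k\<close>. For each \<open>k\<close>, counting by the second
  component integrates the indicator of \<open>A k\<close> shifted by \<open>T' k\<close>, which does not change the integral.\<close>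

lemma mass_transport:
  fixes M :: "'x measure" and T T' :: "nat \<Rightarrow> 'x \<Rightarrow> 'x" and F :: "'x rel"
  defines "out x \<equiv> emeasure (count_space UNIV) {y. (\<exists>k. y = T k x) \<and> (x, y) \<in> F}"
    and "inc y \<equiv> emeasure (count_space UNIV) {x. (\<exists>k. y = T k x) \<and> (x, y) \<in> F}"
  assumes sp: "space M = UNIV"
    and T': "\<And>k. T' k \<in> measurable M M" "\<And>k. distr M M (T' k) = M"
    and inv: "\<And>k x. T k (T' k x) = x" "\<And>k x. T' k (T k x) = x"
    and F: "\<And>k. {x. (x, T k x) \<in> F} \<in> sets M"
    and diag: "\<And>j k. {x. T j x = T k x} \<in> sets M"
  shows "out \<in> borel_measurable M" "inc \<in> borel_measurable M"
    "(\<integral>\<^sup>+x. out x \<partial>M) = (\<integral>\<^sup>+x. inc x \<partial>M)"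
proof -
  define A where "A k = {x. (x, T k x) \<in> F \<and> (\<forall>j<k. T j x \<noteq> T k x)}" for k
  have A: "A k \<in> sets M" for k
  proof -
    have "A k = {x. (x, T k x) \<in> F} \<inter> (\<Inter>j\<in>{..<k}. space M - {x. T j x = T k x}) \<inter> space M"
      by (auto simp: A_def sp)
    also have "\<dots> \<in> sets M"
      using F diag by (cases "k = 0") (auto intro!: sets.Int sets.finite_INT)
    finally show ?thesis .
  qed
  have least: "\<exists>k. y = T k x \<and> x \<in> A k" if "\<exists>k. y = T k x" "(x, y) \<in> F" for x y
  proof -
    define k where "k = (LEAST k. y = T k x)"
    have "y = T k x" unfolding k_def using that(1) by (rule LeastI_ex)
    moreover have "T j x \<noteq> y" if "j < k" for j
      using not_less_Least that unfolding k_def by metis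
    ultimately show ?thesis using that(2) by (auto simp: A_def)
  qed
  have uniq: "j = k" if "x \<in> A j" "x \<in> A k" "T j x = T k x" for x j k
    using that by (cases j k rule: linorder_cases) (auto simp: A_def)
  have out: "out x = (\<Sum>k. indicator (A k) x)" for x
  proof -
    have "{y. (\<exists>k. y = T k x) \<and> (x, y) \<in> F} = (\<lambda>k. T k x) ` {k. x \<in> A k}"
      using least by (fastforce simp: A_def)
    moreover have "inj_on (\<lambda>k. T k x) {k. x \<in> A k}"
      using uniq by (auto intro: inj_onI)
    ultimately show ?thesis
      unfolding out_def by (simp add: emeasure_count_space_image_nat indicator_def)
  qed
  have inc: "inc y = (\<Sum>k. indicator (A k) (T' k y))" for y
  proof -
    have "{x. (\<exists>k. y = T k x) \<and> (x, y) \<in> F} = (\<lambda>k. T' k y) ` {k. T' k y \<in> A k}"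
    proof
      show "{x. (\<exists>k. y = T k x) \<and> (x, y) \<in> F} \<subseteq> (\<lambda>k. T' k y) ` {k. T' k y \<in> A k}"
      proof
        fix x assume "x \<in> {x. (\<exists>k. y = T k x) \<and> (x, y) \<in> F}"
        then obtain k where k: "y = T k x" "x \<in> A k" using least[of y x] by auto
        then have "T' k y = x" using inv(2) by simp
        then show "x \<in> (\<lambda>k. T' k y) ` {k. T' k y \<in> A k}" using k(2) by auto
      qed
      show "(\<lambda>k. T' k y) ` {k. T' k y \<in> A k} \<subseteq> {x. (\<exists>k. y = T k x) \<and> (x, y) \<in> F}"
      proof
        fix x assume "x \<in> (\<lambda>k. T' k y) ` {k. T' k y \<in> A k}"
        then obtain k where k: "x = T' k y" "x \<in> A k" by auto
        then have "y = T k x" using inv(1) by simp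
        then show "x \<in> {x. (\<exists>k. y = T k x) \<and> (x, y) \<in> F}" using k(2) by (auto simp: A_def)
      qed
    qed
    moreover have "inj_on (\<lambda>k. T' k y) {k. T' k y \<in> A k}"
    proof (rule inj_onI)
      fix j k assume jk: "j \<in> {k. T' k y \<in> A k}" "k \<in> {k. T' k y \<in> A k}" "T' j y = T' k y"
      have "T j (T' k y) = T k (T' k y)" using inv(1)[of j y] inv(1)[of k y] jk(3) by simp
      then show "j = k" using uniq[of "T' k y" j k] jk by simp
    qed
    ultimately show ?thesis
      unfolding inc_def by (simp add: emeasure_count_space_image_nat indicator_def)
  qed
  have m1: "(\<lambda>x. indicator (A k) x :: ennreal) \<in> borel_measurable M" for k
    using A by simp
  have m2: "(\<lambda>x. indicator (A k) (T' k x) :: ennreal) \<in> borel_measurable M" for k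
    by (rule measurable_compose[OF T'(1) m1])
  show "out \<in> borel_measurable M"
    using borel_measurable_suminf[of "\<lambda>k. indicator (A k)" M] m1 by (simp add: out[abs_def])
  show "inc \<in> borel_measurable M"
    using borel_measurable_suminf[of "\<lambda>k x. indicator (A k) (T' k x)" M] m2 by (simp add: inc[abs_def])
  have "(\<integral>\<^sup>+x. out x \<partial>M) = (\<Sum>k. \<integral>\<^sup>+x. indicator (A k) x \<partial>M)"
    unfolding out by (rule nn_integral_suminf) (rule m1)
  also have "\<dots> = (\<Sum>k. \<integral>\<^sup>+x. indicator (A k) (T' k x) \<partial>M)"
  proof (rule suminf_cong)
    fix k
    have "(\<integral>\<^sup>+x. indicator (A k) x \<partial>M) = (\<integral>\<^sup>+x. indicator (A k) x \<partial>distr M M (T' k))"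
      by (simp only: T'(2))
    also have "\<dots> = (\<integral>\<^sup>+x. indicator (A k) (T' k x) \<partial>M)"
      by (rule nn_integral_distr[OF T'(1)]) (use A in simp)
    finally show "(\<integral>\<^sup>+x. indicator (A k) x \<partial>M) = (\<integral>\<^sup>+x. indicator (A k) (T' k x) \<partial>M :: ennreal)" .
  qed
  also have "\<dots> = (\<integral>\<^sup>+x. inc x \<partial>M)"
    unfolding inc by (rule nn_integral_suminf[symmetric]) (rule m2)
  finally show "(\<integral>\<^sup>+x. out x \<partial>M) = (\<integral>\<^sup>+x. inc x \<partial>M)" .
qed

section \<open>Coin flips\<close>

definition coin_flips :: "(nat \<Rightarrow> bool) measure" where
  "coin_flips = Pi\<^sub>M UNIV (\<lambda>_. measure_pmf (bernoulli_pmf (1 / 2)))"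

interpretation coin_flips: product_prob_space "\<lambda>_ :: nat. measure_pmf (bernoulli_pmf (1 / 2))" UNIV
  by unfold_locales

lemma prob_space_coin_flips: "prob_space coin_flips"
  unfolding coin_flips_def by (rule coin_flips.P.prob_space_axioms)

lemma space_coin_flips [simp]: "space coin_flips = UNIV"
  by (simp add: coin_flips_def space_PiM)

lemma measurable_coin [measurable]: "(\<lambda>\<omega>. \<omega> n) \<in> measurable coin_flips (count_space UNIV)"
  unfolding coin_flips_def by measurable

lemma sets_coin_event: "{\<omega>. \<omega> n = b} \<in> sets coin_flips"
  using measurable_sets[OF measurable_coin[of n], of "{b}"] by (simp add: vimage_def)

lemma measurable_coin_flipsI:
  assumes "\<And>n. {x \<in> space M. f x n} \<in> sets M"
  shows "f \<in> measurable M coin_flips"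
proof -
  have "(\<lambda>x. f x n) \<in> measurable M (measure_pmf (bernoulli_pmf (1 / 2)))" for n
    using assms[of n] by (simp add: pred_def)
  then show ?thesis
    unfolding coin_flips_def by (intro measurable_PiM_single') (auto simp: space_PiM)
qed

lemma measurable_coin_reindex: "(\<lambda>\<omega>. \<omega> \<circ> \<pi>) \<in> measurable coin_flips coin_flips"
  by (rule measurable_coin_flipsI) (use sets_coin_event[of "\<pi> _" True] in simp)

lemma distr_coin_reindex:
  assumes "inj \<pi>"
  shows "distr coin_flips coin_flips (\<lambda>\<omega>. \<omega> \<circ> \<pi>) = coin_flips"
proof -
  have "distr coin_flips coin_flips (\<lambda>\<omega>. \<lambda>n\<in>UNIV. \<omega> (\<pi> n)) = coin_flips"
    unfolding coin_flips_def using assms by (intro distr_PiM_reindex) (auto intro: prob_space_measure_pmf)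
  then show ?thesis by (simp only: restrict_UNIV comp_def)
qed

lemma emeasure_coin_cylinder:
  "emeasure coin_flips {\<omega>. \<forall>n<N. \<omega> n = b n} = ennreal ((1 / 2) ^ N)"
proof -
  have "{\<omega>. \<forall>n<N. \<omega> n = b n} =
      prod_emb UNIV (\<lambda>_. measure_pmf (bernoulli_pmf (1 / 2))) {..<N} (Pi\<^sub>E {..<N} (\<lambda>n. {b n}))"
    by (auto simp: prod_emb_def PiE_iff restrict_def)
  then have "emeasure coin_flips {\<omega>. \<forall>n<N. \<omega> n = b n} =
      (\<Prod>n<N. emeasure (measure_pmf (bernoulli_pmf (1 / 2))) {b n})"
    unfolding coin_flips_def by (simp only:) (rule coin_flips.emeasure_PiM_emb, auto)
  also have "\<dots> = (\<Prod>n<N. ennreal (1 / 2))"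
    by (intro prod.cong refl) (auto simp: emeasure_pmf_single pmf_bernoulli_half)
  also have "\<dots> = ennreal (1 / 2) ^ N" by (simp only: prod_constant card_lessThan)
  also have "\<dots> = ennreal ((1 / 2) ^ N)" by (rule ennreal_power) simp
  finally show ?thesis .
qed

lemma emeasure_coin_singleton: "emeasure coin_flips {b} = 0"
proof -
  have "emeasure coin_flips {b} \<le> ennreal ((1 / 2) ^ N)" for N
  proof -
    have "{\<omega>. \<forall>n<N. \<omega> n = b n} \<in> sets coin_flips"
      using emeasure_coin_cylinder[of N b] emeasure_notin_sets by fastforce
    then have "emeasure coin_flips {b} \<le> emeasure coin_flips {\<omega>. \<forall>n<N. \<omega> n = b n}"
      by (intro emeasure_mono) auto
    then show ?thesis by (simp add: emeasure_coin_cylinder)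
  qed
  moreover have "(\<lambda>N. ennreal ((1 / 2) ^ N)) \<longlonglongrightarrow> ennreal 0"
    by (intro tendsto_ennrealI LIMSEQ_realpow_zero) auto
  ultimately have "emeasure coin_flips {b} \<le> ennreal 0"
    by (intro tendsto_lowerbound) auto
  then show ?thesis by simp
qed

text \<open>Otherwise each coin would be almost surely constant on \<open>D\<close>, and \<open>D\<close> would be concentrated on a single
  sequence of outcomes.\<close>

lemma coin_splits_event:
  assumes D: "D \<in> sets coin_flips" "emeasure coin_flips D > 0"
  obtains n where "0 < emeasure coin_flips (D \<inter> {\<omega>. \<omega> n})"
    "emeasure coin_flips (D \<inter> {\<omega>. \<omega> n}) < emeasure coin_flips D"
proof (rule ccontr)
  interpret prob_space coin_flips by (rule prob_space_coin_flips)
  have ev: "{\<omega>. \<omega> n} \<in> sets coin_flips" "{\<omega>. \<not> \<omega> n} \<in> sets coin_flips" for n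
    using sets_coin_event[of n True] sets_coin_event[of n False] by simp_all
  have split: "emeasure coin_flips D =
      emeasure coin_flips (D \<inter> {\<omega>. \<omega> n}) + emeasure coin_flips (D \<inter> {\<omega>. \<not> \<omega> n})" for n
    using D(1) ev by (subst plus_emeasure) (auto intro!: arg_cong[where f = "emeasure coin_flips"])
  assume no: "\<not> thesis"
  have null: "\<exists>b. emeasure coin_flips (D \<inter> {\<omega>. \<omega> n \<noteq> b}) = 0" for n
  proof (cases "emeasure coin_flips (D \<inter> {\<omega>. \<omega> n}) = 0")
    case True
    then show ?thesis by (intro exI[of _ False]) simp
  next
    case False
    then have "\<not> emeasure coin_flips (D \<inter> {\<omega>. \<omega> n}) < emeasure coin_flips D"
      using no that by (metis not_gr_zero)
    then have "emeasure coin_flips (D \<inter> {\<omega>. \<omega> n}) + emeasure coin_flips (D \<inter> {\<omega>. \<not> \<omega> n})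
        \<le> emeasure coin_flips (D \<inter> {\<omega>. \<omega> n}) + 0"
      using split[of n] by simp
    then have "emeasure coin_flips (D \<inter> {\<omega>. \<not> \<omega> n}) = 0"
      by (subst (asm) ennreal_add_left_cancel_le) auto
    then show ?thesis by (intro exI[of _ True]) simp
  qed
  then obtain b where b: "\<And>n. emeasure coin_flips (D \<inter> {\<omega>. \<omega> n \<noteq> b n}) = 0" by metis
  have "D \<subseteq> {b} \<union> (\<Union>n. D \<inter> {\<omega>. \<omega> n \<noteq> b n})" by auto
  have s: "D \<inter> {\<omega>. \<omega> n \<noteq> b n} \<in> sets coin_flips" for n
    using D(1) sets_coin_event[of n "\<not> b n"] by (auto intro!: sets.Int simp: eq_commute)
  have "(\<Union>n. D \<inter> {\<omega>. \<omega> n \<noteq> b n}) \<in> null_sets coin_flips"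
    using b s by (intro null_sets_UN) auto
  moreover have "{b} \<in> null_sets coin_flips"
  proof -
    have "{b} = (\<Inter>n. {\<omega>. \<omega> n = b n})" by auto
    also have "\<dots> \<in> sets coin_flips" using sets_coin_event by blast
    finally show ?thesis using emeasure_coin_singleton by (simp add: null_sets_def)
  qed
  ultimately have "{b} \<union> (\<Union>n. D \<inter> {\<omega>. \<omega> n \<noteq> b n}) \<in> null_sets coin_flips"
    using null_sets.Un by blast
  then have "emeasure coin_flips D = 0"
    using D(1) \<open>D \<subseteq> _\<close> by (meson null_setsD1 null_sets_subset)
  then show False using D(2) by simp
qed

lemma sets_coin_flips_if_finite_dependence:
  assumes "\<And>\<omega>. \<omega> \<in> U \<Longrightarrow> \<exists>N. \<forall>\<omega>'. (\<forall>n<N. \<omega>' n = \<omega> n) \<longrightarrow> \<omega>' \<in> U"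
  shows "U \<in> sets coin_flips"
proof -
  define Cyl where "Cyl bs = {\<omega> :: nat \<Rightarrow> bool. \<forall>n\<in>{..<length bs}. \<omega> n = bs ! n}" for bs
  have Cyl: "Cyl bs \<in> sets coin_flips" for bs
  proof -
    have "Cyl bs = (\<Inter>n\<in>{..<length bs}. {\<omega>. \<omega> n = bs ! n}) \<inter> space coin_flips" by (auto simp: Cyl_def)
    then show ?thesis
      using sets_coin_event sets.top[of coin_flips]
      by (cases "bs = []") (auto intro!: sets.finite_INT)
  qed
  have "U = (\<Union>bs\<in>{bs. Cyl bs \<subseteq> U}. Cyl bs)"
  proof
    show "U \<subseteq> (\<Union>bs\<in>{bs. Cyl bs \<subseteq> U}. Cyl bs)"
    proof
      fix \<omega> assume "\<omega> \<in> U"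
      then obtain N where N: "\<And>\<omega>'. (\<forall>n<N. \<omega>' n = \<omega> n) \<Longrightarrow> \<omega>' \<in> U" using assms by blast
      have "Cyl (map \<omega> [0..<N]) \<subseteq> U" using N by (auto simp: Cyl_def)
      moreover have "\<omega> \<in> Cyl (map \<omega> [0..<N])" by (auto simp: Cyl_def)
      ultimately show "\<omega> \<in> (\<Union>bs\<in>{bs. Cyl bs \<subseteq> U}. Cyl bs)" by blast
    qed
  qed auto
  also have "\<dots> \<in> sets coin_flips"
    using Cyl by (intro sets.countable_UN' countableI_type) auto
  finally show ?thesis .
qed

text \<open>The hypothesis \<open>dep\<close> is continuity in the product topology. As there are only countably
  many cylinders of coin outcomes, preimages of arbitrary open sets, including uncountable unions of
  basic ones, are measurable.\<close>

lemma measurable_coin_flips_topology: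
  assumes range: "\<And>\<omega>. f \<omega> \<in> \<Union>B"
    and dep: "\<And>V \<omega>. V \<in> B \<Longrightarrow> f \<omega> \<in> V \<Longrightarrow> \<exists>N. \<forall>\<omega>'. (\<forall>n<N. \<omega>' n = \<omega> n) \<longrightarrow> f \<omega>' \<in> V"
  shows "f \<in> measurable coin_flips (borel_of_topology (topology_generated_by B))"
proof (rule measurable_borel_of_topologyI)
  show "f \<in> space coin_flips \<rightarrow> topspace (topology_generated_by B)"
    using range by (auto simp: topology_generated_by_topspace)
  fix U assume "openin (topology_generated_by B) U"
  then have "generate_topology_on B U" by (rule openin_topology_generated_by)
  then have "\<exists>N. \<forall>\<omega>'. (\<forall>n<N. \<omega>' n = \<omega> n) \<longrightarrow> f \<omega>' \<in> U" if "f \<omega> \<in> U" for \<omega>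
    using that
  proof (induction arbitrary: \<omega>)
    case (Int U V)
    then obtain N N' where "\<And>\<omega>'. (\<forall>n<N. \<omega>' n = \<omega> n) \<Longrightarrow> f \<omega>' \<in> U"
      "\<And>\<omega>'. (\<forall>n<N'. \<omega>' n = \<omega> n) \<Longrightarrow> f \<omega>' \<in> V" by (metis IntE)
    then show ?case by (intro exI[of _ "max N N'"]) auto
  next
    case (UN K)
    then show ?case by (metis Union_iff)
  qed (use dep in auto)
  then show "f -` U \<inter> space coin_flips \<in> sets coin_flips"
    by (intro sets_coin_flips_if_finite_dependence) auto
qed

section \<open>Cayley graphs with flipped labels\<close>

text \<open>The function \<open>coset\<close> is meant to number the left cosets, without gaps, of a subgroup of infinite index that contains
  \<open>gs ! 1\<close>. Only the consequences below of this choice matter: the number does not change along the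
  edges of the generators \<open>0\<close> and \<open>1\<close>, and left translations act on the numbers.\<close>

locale flippable_cayley = group G for G :: "('a, 'b) monoid_scheme" (structure) +
  fixes gs :: "'a list" and coset :: "'a \<Rightarrow> nat"
  assumes gs: "distinct gs" "set gs \<subseteq> carrier G" "2 \<le> length gs" "gs ! 0 = \<one>"
    and generate_rest: "generate G (set (drop 2 gs)) = carrier G"
    and coset_mult: "\<And>x. x \<in> carrier G \<Longrightarrow> coset (x \<otimes> gs ! 1) = coset x"
    and coset_translate: "\<And>g x y. g \<in> carrier G \<Longrightarrow> x \<in> carrier G \<Longrightarrow> y \<in> carrier G \<Longrightarrow>
      coset x = coset y \<Longrightarrow> coset (g \<otimes> x) = coset (g \<otimes> y)"
    and coset_surj: "coset ` carrier G = UNIV"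
    and countable_carrier: "countable (carrier G)"
begin

abbreviation m :: nat where "m \<equiv> length gs"

definition flip :: "(nat \<Rightarrow> bool) \<Rightarrow> 'a \<Rightarrow> nat \<Rightarrow> nat" where
  "flip \<omega> g i = (if i < 2 \<and> \<omega> (coset g) then 1 - i else i)"

definition flipped :: "(nat \<Rightarrow> bool) \<Rightarrow> ('a, 'a \<times> nat) lgraph" where
  "flipped \<omega> = (cayley_graph G gs)\<lparr>label := \<lambda>(g, i). flip \<omega> g i\<rparr>"

lemma flipped_simps [simp]:
  "verts (flipped \<omega>) = carrier G" "edges (flipped \<omega>) = carrier G \<times> {..<m}" "base (flipped \<omega>) = \<one>"
  "ends (flipped \<omega>) (g, i) = Upair g (g \<otimes> gs ! i)" "tail (flipped \<omega>) (g, i) = g"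
  "head (flipped \<omega>) (g, i) = g \<otimes> gs ! i" "label (flipped \<omega>) (g, i) = flip \<omega> g i"
  by (simp_all add: flipped_def cayley_graph_def)

lemma gs_closed [simp]: "i < m \<Longrightarrow> gs ! i \<in> carrier G"
  using gs(2) nth_mem by blast

lemma flip_less: "i < m \<Longrightarrow> flip \<omega> g i < m"
  using gs(3) by (auto simp: flip_def)

lemma flip_flip [simp]: "flip \<omega> g (flip \<omega> g i) = i"
  by (auto simp: flip_def)

text \<open>The two ends of an edge see the same coin whenever it matters, so an edge has the same label from
  either end.\<close>

lemma flip_head: "g \<in> carrier G \<Longrightarrow> flip \<omega> (g \<otimes> gs ! i) i = flip \<omega> g i"
  using gs(4) coset_mult by (auto simp: flip_def less_2_cases_iff)

lemma adj_flipped: "adj (flipped \<omega>) = adj (flipped \<omega>')"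
  by (simp add: adj_def flipped_def)

lemma flipped_connected:
  assumes "u \<in> carrier G" "v \<in> carrier G"
  shows "(u, v) \<in> (adj (flipped \<omega>))\<^sup>*"
proof -
  have edge: "(u, u \<otimes> gs ! i) \<in> adj (flipped \<omega>)" "(u \<otimes> gs ! i, u) \<in> adj (flipped \<omega>)"
    if "u \<in> carrier G" "i < m" for u i
    using that by (force simp: adj_def)+
  have "(u, u \<otimes> h) \<in> (adj (flipped \<omega>))\<^sup>*" if "h \<in> generate G (set (drop 2 gs))" "u \<in> carrier G" for h u
    using that
  proof (induction arbitrary: u)
    case one
    then show ?case by simp
  next
    case (incl h)
    then obtain i where "i < m" "h = gs ! i" by (metis in_set_conv_nth in_set_dropD)
    then show ?case using edge(1) incl by blast
  next
    case (inv h)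
    then obtain i where i: "i < m" "h = gs ! i" by (metis in_set_conv_nth in_set_dropD)
    have "(u \<otimes> inv h \<otimes> gs ! i, u \<otimes> inv h) \<in> adj (flipped \<omega>)"
      using i inv by (intro edge(2)) auto
    moreover have "u \<otimes> inv h \<otimes> gs ! i = u" using i inv by (simp add: m_assoc)
    ultimately show ?case by auto
  next
    case (eng h1 h2)
    have c: "h1 \<in> carrier G" "h2 \<in> carrier G" using eng generate_rest by auto
    have "(u, u \<otimes> h1) \<in> (adj (flipped \<omega>))\<^sup>*" "(u \<otimes> h1, u \<otimes> h1 \<otimes> h2) \<in> (adj (flipped \<omega>))\<^sup>*"
      using eng c by auto
    then show ?case using c eng.prems by (simp add: m_assoc)
  qed
  from this[of "inv u \<otimes> v" u] show ?thesis
    using assms generate_rest by (simp add: m_assoc[symmetric])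
qed

lemma schreier_graph_flipped: "schreier_graph m (flipped \<omega>)"
proof (rule schreier_graphI)
  show "directed_ends (flipped \<omega>)" by (auto simp: directed_ends_def)
  show "tail (flipped \<omega>) e \<in> verts (flipped \<omega>) \<and> head (flipped \<omega>) e \<in> verts (flipped \<omega>) \<and>
      label (flipped \<omega>) e < m" if "e \<in> edges (flipped \<omega>)" for e
    using that flip_less by auto
  fix v i assume v: "v \<in> verts (flipped \<omega>)" and i: "i < m"
  let ?j = "flip \<omega> v i"
  have j: "?j < m" using flip_less i by blast
  show "\<exists>!e. e \<in> edges (flipped \<omega>) \<and> tail (flipped \<omega>) e = v \<and> label (flipped \<omega>) e = i"
    using v j by (intro ex1I[of _ "(v, ?j)"]) auto
  show "\<exists>!e. e \<in> edges (flipped \<omega>) \<and> head (flipped \<omega>) e = v \<and> label (flipped \<omega>) e = i"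
  proof (rule ex1I[of _ "(v \<otimes> inv (gs ! ?j), ?j)"])
    have c: "v \<otimes> inv (gs ! ?j) \<in> carrier G" using v j by simp
    have h: "v \<otimes> inv (gs ! ?j) \<otimes> gs ! ?j = v" using v j by (simp add: m_assoc)
    have "flip \<omega> (v \<otimes> inv (gs ! ?j)) ?j = i"
      using flip_head[OF c, of \<omega> ?j] h by simp
    then show "(v \<otimes> inv (gs ! ?j), ?j) \<in> edges (flipped \<omega>) \<and> head (flipped \<omega>) (v \<otimes> inv (gs ! ?j), ?j) = v \<and>
        label (flipped \<omega>) (v \<otimes> inv (gs ! ?j), ?j) = i"
      using c h j by simp
    fix e assume e: "e \<in> edges (flipped \<omega>) \<and> head (flipped \<omega>) e = v \<and> label (flipped \<omega>) e = i"
    then obtain g k where gk: "e = (g, k)" "g \<in> carrier G" "k < m" by auto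
    have "flip \<omega> v k = i" using flip_head[of g \<omega> k] e gk by simp
    then have "k = ?j" by auto
    moreover from this have "g = v \<otimes> inv (gs ! ?j)"
      using e gk j v by (intro inv_solve_right[THEN iffD2]) auto
    ultimately show "e = (v \<otimes> inv (gs ! ?j), ?j)" using gk by simp
  qed
qed (use flipped_connected in auto)

lemma countable_graph_flipped: "countable_graph (flipped \<omega>)"
  using countable_carrier by (auto simp: countable_graph_def)

text \<open>The random point of \<open>Lam m\<close> as a function of the coins.\<close>

definition flipped_class :: "(nat \<Rightarrow> bool) \<Rightarrow> (nat, nat) lgraph set" where
  "flipped_class \<omega> = labelled_class m (flipped \<omega>)"

lemma flipped_class_in_Lam: "flipped_class \<omega> \<in> Lam m"
  unfolding flipped_class_def by (rule labelled_class_in_Lam[OF schreier_graph_flipped countable_graph_flipped])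

lemma class_closed_walk_flipped_class: "w \<in> words m \<Longrightarrow> class_closed_walk (flipped_class \<omega>) w \<longleftrightarrow> closed_walk (flipped \<omega>) w"
  unfolding flipped_class_def by (rule class_closed_walk_labelled_class[OF schreier_graph_flipped countable_graph_flipped])

subsection \<open>Recovering the coins\<close>

lemma step_flipped:
  assumes "v \<in> carrier G" "2 \<le> i" "i < m"
  shows "step (flipped \<omega>) (i, True) v = v \<otimes> gs ! i" "step (flipped \<omega>) (i, False) v = v \<otimes> inv (gs ! i)"
proof -
  show "step (flipped \<omega>) (i, True) v = v \<otimes> gs ! i"
    using step_forward[OF schreier_graph_flipped, of "(v, i)" \<omega>] assms by (simp add: flip_def)
  show "step (flipped \<omega>) (i, False) v = v \<otimes> inv (gs ! i)"
    using step_backward[OF schreier_graph_flipped, of "(v \<otimes> inv (gs ! i), i)" \<omega>] assms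
    by (simp add: flip_def m_assoc)
qed

lemma ex_word_to:
  assumes "x \<in> carrier G"
  shows "\<exists>w\<in>words m. \<forall>\<omega>. walk (flipped \<omega>) w = x"
proof -
  have "\<exists>w\<in>words m. \<forall>\<omega>. \<forall>v\<in>carrier G. walk_from (flipped \<omega>) v w = v \<otimes> h"
    if "h \<in> generate G (set (drop 2 gs))" for h
    using that
  proof induction
    case one
    show ?case by (intro bexI[of _ "[]"]) auto
  next
    case (incl h)
    then obtain i where i: "i < m - 2" "h = gs ! (2 + i)"
      by (metis in_set_conv_nth length_drop nth_drop gs(3))
    then show ?case using step_flipped(1)[of _ "2 + i"] by (intro bexI[of _ "[(2 + i, True)]"]) auto
  next
    case (inv h)
    then obtain i where i: "i < m - 2" "h = gs ! (2 + i)"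
      by (metis in_set_conv_nth length_drop nth_drop gs(3))
    then show ?case using step_flipped(2)[of _ "2 + i"] by (intro bexI[of _ "[(2 + i, False)]"]) auto
  next
    case (eng h1 h2)
    then obtain w1 w2 where w: "w1 \<in> words m" "\<forall>\<omega>. \<forall>v\<in>carrier G. walk_from (flipped \<omega>) v w1 = v \<otimes> h1"
      "w2 \<in> words m" "\<forall>\<omega>. \<forall>v\<in>carrier G. walk_from (flipped \<omega>) v w2 = v \<otimes> h2" by blast
    have c: "h1 \<in> carrier G" "h2 \<in> carrier G" using eng generate_rest by auto
    show ?case using w c by (intro bexI[of _ "w1 @ w2"]) (auto simp: m_assoc)
  qed
  then obtain w where "w \<in> words m" "\<forall>\<omega>. \<forall>v\<in>carrier G. walk_from (flipped \<omega>) v w = v \<otimes> x"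
    using assms generate_rest by blast
  then show ?thesis using assms by (intro bexI[of _ w]) auto
qed

text \<open>Walk to the coset with number \<open>n\<close>, take the edge labelled \<open>0\<close>, and walk back. This is a closed walk
  exactly if that edge is a loop.\<close>

lemma ex_coin_word: "\<exists>w\<in>words m. \<forall>\<omega>. closed_walk (flipped \<omega>) w \<longleftrightarrow> \<not> \<omega> n"
proof -
  obtain x where x: "x \<in> carrier G" "coset x = n" using coset_surj by (metis UNIV_I imageE)
  obtain w where w: "w \<in> words m" "\<And>\<omega>. walk (flipped \<omega>) w = x" using ex_word_to[OF x(1)] by blast
  have m0: "0 < m" "1 < m" using gs(3) by auto
  let ?u = "w @ [(0, True)]"
  have u: "?u \<in> words m" using w(1) m0 by simp
  have "closed_walk (flipped \<omega>) (?u @ inverse_word w) \<longleftrightarrow> \<not> \<omega> n" for \<omega>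
  proof -
    have "closed_walk (flipped \<omega>) (?u @ inverse_word w) \<longleftrightarrow> step (flipped \<omega>) (0, True) x = x"
      using closed_walk_append_inverse_word[OF schreier_graph_flipped u w(1)] w(2) by simp
    also have "step (flipped \<omega>) (0, True) x = x \<otimes> gs ! flip \<omega> x 0"
      using step_forward[OF schreier_graph_flipped, of "(x, flip \<omega> x 0)" \<omega>] x(1) flip_less[OF m0(1)]
      by simp
    also have "x \<otimes> gs ! flip \<omega> x 0 = x \<longleftrightarrow> gs ! flip \<omega> x 0 = gs ! 0"
      using x(1) flip_less[OF m0(1)] gs(4) by simp
    also have "\<dots> \<longleftrightarrow> flip \<omega> x 0 = 0"
      using gs(1) flip_less[OF m0(1)] m0(1) by (simp add: nth_eq_iff_index_eq)
    also have "\<dots> \<longleftrightarrow> \<not> \<omega> n" using x(2) by (simp add: flip_def)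
    finally show ?thesis .
  qed
  then show ?thesis using u w(1) by (intro bexI[of _ "?u @ inverse_word w"]) auto
qed

definition coin_word :: "nat \<Rightarrow> (nat \<times> bool) list" where
  "coin_word n = (SOME w. w \<in> words m \<and> (\<forall>\<omega>. closed_walk (flipped \<omega>) w \<longleftrightarrow> \<not> \<omega> n))"

lemma coin_word: "coin_word n \<in> words m" "closed_walk (flipped \<omega>) (coin_word n) \<longleftrightarrow> \<not> \<omega> n"
proof -
  have "\<exists>w. w \<in> words m \<and> (\<forall>\<omega>. closed_walk (flipped \<omega>) w \<longleftrightarrow> \<not> \<omega> n)"
    using ex_coin_word[of n] by auto
  from someI_ex[OF this] show "coin_word n \<in> words m" "closed_walk (flipped \<omega>) (coin_word n) \<longleftrightarrow> \<not> \<omega> n"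
    unfolding coin_word_def by auto
qed

definition coins_of :: "(nat, nat) lgraph set \<Rightarrow> nat \<Rightarrow> bool" where
  "coins_of C n \<longleftrightarrow> \<not> class_closed_walk C (coin_word n)"

lemma coins_of_flipped_class [simp]: "coins_of (flipped_class \<omega>) = \<omega>"
  by (rule ext) (simp add: coins_of_def class_closed_walk_flipped_class coin_word)

lemma flipped_class_eq_iff [simp]: "flipped_class \<omega> = flipped_class \<omega>' \<longleftrightarrow> \<omega> = \<omega>'"
  by (metis coins_of_flipped_class)

subsection \<open>The random Schreier graph\<close>

abbreviation borel_Lam :: "(nat, nat) lgraph set measure" where
  "borel_Lam \<equiv> borel_of_topology (topology_Lam m)"

abbreviation borel_Omega :: "(nat, nat) rgraph set measure" where
  "borel_Omega \<equiv> borel_of_topology (topology_Omega m)"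

lemma nbhd_flipped_eq:
  assumes "\<And>g. g \<in> root_ball r (flipped \<omega>) \<Longrightarrow> \<omega>' (coset g) = \<omega> (coset g)"
  shows "labelled_rooted_iso (nbhd r (flipped \<omega>')) (nbhd r (flipped \<omega>))"
proof -
  have ball: "root_ball r (flipped \<omega>') = root_ball r (flipped \<omega>)"
    using adj_flipped[of \<omega>' \<omega>] by (simp add: root_ball_def)
  have ends: "ends (flipped \<omega>') = ends (flipped \<omega>)" by (simp add: flipped_def)
  have "labelled_iso_map id id (nbhd r (flipped \<omega>')) (nbhd r (flipped \<omega>))"
    unfolding labelled_iso_map_def graph_iso_map_def
    using assms by (auto simp: nbhd_def ball ends uprod.map_id flip_def)
  then show ?thesis
    unfolding labelled_rooted_iso_def by (intro exI[of _ id]) auto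
qed

text \<open>The neighbourhood of radius \<open>r\<close> is finite, so its labels depend on finitely many coins.\<close>

lemma measurable_flipped_class [measurable]: "flipped_class \<in> measurable coin_flips borel_Lam"
  unfolding topology_Lam_def
proof (rule measurable_coin_flips_topology)
  show "flipped_class \<omega> \<in> \<Union>{cylinder_Lam m r U |r U. True}" for \<omega>
    using flipped_class_in_Lam[of \<omega>] unfolding topspace_topology_Lam[symmetric] topology_Lam_def
      topology_generated_by_topspace .
  fix V \<omega> assume "V \<in> {cylinder_Lam m r U |r U. True}" and V: "flipped_class \<omega> \<in> V"
  then obtain r U where U: "V = cylinder_Lam m r U" by auto
  have iff: "flipped_class \<omega> \<in> V \<longleftrightarrow> labelled_rooted_iso (nbhd r (flipped \<omega>)) U" for \<omega>
    unfolding U flipped_class_def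
    by (rule labelled_class_in_cylinder_iff[OF schreier_graph_flipped countable_graph_flipped])
  have "finite (root_ball r (flipped \<omega>))"
    using schreier_graph_flipped[of \<omega>] unfolding schreier_graph_def by (blast intro: finite_root_ball)
  then obtain N where N: "\<And>g. g \<in> root_ball r (flipped \<omega>) \<Longrightarrow> coset g < N"
    using finite_nat_set_iff_bounded[of "coset ` root_ball r (flipped \<omega>)"] by auto
  show "\<exists>N. \<forall>\<omega>'. (\<forall>n<N. \<omega>' n = \<omega> n) \<longrightarrow> flipped_class \<omega>' \<in> V"
  proof (intro exI[of _ N] allI impI)
    fix \<omega>' assume eq: "\<forall>n<N. \<omega>' n = \<omega> n"
    have "labelled_rooted_iso (nbhd r (flipped \<omega>')) (nbhd r (flipped \<omega>))"
      using eq N by (intro nbhd_flipped_eq) auto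
    then have "labelled_rooted_iso (nbhd r (flipped \<omega>')) U"
      using V[unfolded iff] by (rule labelled_rooted_iso_trans)
    then show "flipped_class \<omega>' \<in> V" by (simp add: iff)
  qed
qed

lemma sets_closed_walk: "w \<in> words m \<Longrightarrow> {C \<in> Lam m. class_closed_walk C w = b} \<in> sets borel_Lam"
  by (intro openin_in_sets_borel openin_closed_walk)

lemma measurable_coins_of [measurable]: "coins_of \<in> measurable borel_Lam coin_flips"
proof (rule measurable_coin_flipsI)
  fix n
  have "{C \<in> space borel_Lam. coins_of C n} = {C \<in> Lam m. class_closed_walk C (coin_word n) = False}"
    by (auto simp: coins_of_def topspace_topology_Lam)
  then show "{C \<in> space borel_Lam. coins_of C n} \<in> sets borel_Lam"
    using sets_closed_walk[OF coin_word(1), of n False] by simp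
qed

definition flipped_law :: "(nat, nat) lgraph set measure" where
  "flipped_law = distr coin_flips borel_Lam flipped_class"

lemma sets_flipped_law [simp, measurable_cong]: "sets flipped_law = sets borel_Lam"
  by (simp add: flipped_law_def)

lemma space_flipped_law: "space flipped_law = Lam m"
  by (simp add: flipped_law_def topspace_topology_Lam)

lemma prob_space_flipped_law: "prob_space flipped_law"
  unfolding flipped_law_def by (rule prob_space.prob_space_distr[OF prob_space_coin_flips measurable_flipped_class])

lemma emeasure_flipped_law: "A \<in> sets borel_Lam \<Longrightarrow> emeasure flipped_law A = emeasure coin_flips (flipped_class -` A)"
  unfolding flipped_law_def by (simp add: emeasure_distr)

lemma nonatomic_flipped_law: "nonatomic flipped_law"
  unfolding nonatomic_def
proof (intro ballI impI)
  fix A assume A: "A \<in> sets flipped_law" "emeasure flipped_law A > 0"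
  have D: "flipped_class -` A \<in> sets coin_flips" using measurable_sets[OF measurable_flipped_class, of A] A(1) by simp
  obtain n where n: "0 < emeasure coin_flips (flipped_class -` A \<inter> {\<omega>. \<omega> n})"
    "emeasure coin_flips (flipped_class -` A \<inter> {\<omega>. \<omega> n}) < emeasure coin_flips (flipped_class -` A)"
    using coin_splits_event[OF D] A emeasure_flipped_law by auto
  define B where "B = A \<inter> {C \<in> Lam m. class_closed_walk C (coin_word n) = False}"
  have B: "B \<in> sets borel_Lam"
    unfolding B_def using A(1) sets_closed_walk[OF coin_word(1), of n False] by (intro sets.Int) auto
  have "flipped_class -` B = flipped_class -` A \<inter> {\<omega>. \<omega> n}"
    by (auto simp: B_def flipped_class_in_Lam class_closed_walk_flipped_class coin_word)
  then show "\<exists>B\<in>sets flipped_law. B \<subseteq> A \<and> 0 < emeasure flipped_law B \<and> emeasure flipped_law B < emeasure flipped_law A"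
    using n B A(1) by (intro bexI[of _ B]) (auto simp: emeasure_flipped_law B_def)
qed

lemma distr_forget_flipped_law:
  "distr flipped_law borel_Omega (forget m) = return borel_Omega (unlabelled_class m (cayley_graph G gs))"
proof -
  have un: "unlabelled_class m (flipped \<omega>) = unlabelled_class m (cayley_graph G gs)" for \<omega>
    by (simp add: unlabelled_class_def rooted_iso_def graph_iso_map_def flipped_def)
  have *: "forget m (flipped_class \<omega>) = unlabelled_class m (cayley_graph G gs)" for \<omega>
    unfolding flipped_class_def un[symmetric, of \<omega>]
    by (rule forget_labelled_class[OF schreier_graph_flipped countable_graph_flipped])
  have "unlabelled_class m (cayley_graph G gs) \<in> space borel_Omega"
    using unlabelled_class_in_Omega[OF schreier_graph_flipped countable_graph_flipped]
    by (simp add: un topspace_topology_Omega)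
  then have "distr coin_flips borel_Omega (\<lambda>_. unlabelled_class m (cayley_graph G gs)) =
      return borel_Omega (unlabelled_class m (cayley_graph G gs))"
    by (rule prob_space.distr_const[OF prob_space_coin_flips])
  moreover have "distr flipped_law borel_Omega (forget m) = distr coin_flips borel_Omega (forget m \<circ> flipped_class)"
    unfolding flipped_law_def
    by (rule distr_distr[OF continuous_map_measurable_borel[OF continuous_map_forget] measurable_flipped_class])
  ultimately show ?thesis by (simp add: comp_def *)
qed

subsection \<open>Invariance\<close>

text \<open>The permutation of the coset numbers induced by left multiplication with \<open>g\<close>.\<close>

definition translate :: "'a \<Rightarrow> nat \<Rightarrow> nat" where
  "translate g n = coset (g \<otimes> (SOME x. x \<in> carrier G \<and> coset x = n))"

lemma translate_coset:
  assumes "g \<in> carrier G" "x \<in> carrier G"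
  shows "translate g (coset x) = coset (g \<otimes> x)"
proof -
  have "\<exists>y. y \<in> carrier G \<and> coset y = coset x" using assms by blast
  from someI_ex[OF this] show ?thesis
    unfolding translate_def using assms by (intro coset_translate) auto
qed

lemma translate_inv:
  assumes g: "g \<in> carrier G"
  shows "translate (inv g) (translate g n) = n" "translate g (translate (inv g) n) = n"
proof -
  obtain x where x: "x \<in> carrier G" "n = coset x" using coset_surj by (metis UNIV_I imageE)
  show "translate (inv g) (translate g n) = n"
    using g x by (simp add: translate_coset m_assoc[symmetric])
  show "translate g (translate (inv g) n) = n"
    using g x by (simp add: translate_coset m_assoc[symmetric])
qed

lemma inj_translate: "g \<in> carrier G \<Longrightarrow> inj (translate g)"
  by (metis injI translate_inv(1))

lemma translation_iso:
  assumes g: "g \<in> carrier G"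
  shows "labelled_iso_map (\<lambda>x. g \<otimes> x) (\<lambda>(x, i). (g \<otimes> x, i)) (flipped (\<omega> \<circ> translate g)) (flipped \<omega>)"
proof -
  have inj: "g \<otimes> x = g \<otimes> y \<longleftrightarrow> x = y" if "x \<in> carrier G" "y \<in> carrier G" for x y
    using that g by simp
  have surj: "y = g \<otimes> (inv g \<otimes> y)" if "y \<in> carrier G" for y
    using that g by (simp add: m_assoc[symmetric])
  have "bij_betw (\<lambda>x. g \<otimes> x) (carrier G) (carrier G)"
    unfolding bij_betw_def inj_on_def using inj surj g by (auto simp: image_iff)
  moreover have "bij_betw (\<lambda>(x, i). (g \<otimes> x, i)) (carrier G \<times> {..<m}) (carrier G \<times> {..<m})"
    unfolding bij_betw_def inj_on_def using inj surj g
    by (auto simp: image_iff) (metis SigmaI inv_closed lessThan_iff m_closed case_prod_conv)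
  ultimately show ?thesis
    unfolding labelled_iso_map_def graph_iso_map_def
    using g by (auto simp: m_assoc flip_def translate_coset)
qed

text \<open>A Schreier graph isomorphic to \<open>flipped \<omega>\<close> up to the root is \<open>flipped \<omega>\<close> with another root \<open>g\<close>,
  and left translation by \<open>g\<^sup>-\<^sup>1\<close> turns this into the graph of the permuted coins with root \<open>\<one>\<close>.\<close>

lemma schreier_rel_flipped_class: "(flipped_class \<omega>, D) \<in> schreier_rel m \<longleftrightarrow> (\<exists>g\<in>carrier G. D = flipped_class (\<omega> \<circ> translate g))"
proof
  assume "(flipped_class \<omega>, D) \<in> schreier_rel m"
  then obtain S T where ST: "S \<in> flipped_class \<omega>" "T \<in> D" "labelled_unrooted_iso S T" and D: "D \<in> Lam m"
    by (auto simp: schreier_rel_def)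
  have T: "schreier_graph m T" "D = labelled_class m T"
  proof -
    obtain T' :: "(nat, nat) lgraph" where T': "schreier_graph m T'" "D = labelled_class m T'" using D by (rule Lam_cases)
    then show "schreier_graph m T" using ST(2) labelled_classD by metis
    show "D = labelled_class m T"
      using T' ST(2) labelled_classD[of T m T'] labelled_class_eqI[OF T'(1), of T] by simp
  qed
  have "labelled_unrooted_iso (flipped \<omega>) S"
    using ST(1) labelled_classD labelled_rooted_imp_unrooted_iso unfolding flipped_class_def by metis
  then have "labelled_unrooted_iso (flipped \<omega>) T" using ST(3) by (rule labelled_unrooted_iso_trans)
  then obtain \<alpha> \<beta> where iso: "labelled_iso_map \<alpha> \<beta> (flipped \<omega>) T"
    by (auto simp: labelled_unrooted_iso_def)
  then have "\<alpha> ` carrier G = verts T"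
    by (auto simp: labelled_iso_map_def graph_iso_map_def bij_betw_def)
  then obtain g where g: "g \<in> carrier G" "\<alpha> g = base T"
    using schreier_graphD(2)[OF T(1)] by (metis imageE)
  have "labelled_rooted_iso (flipped (\<omega> \<circ> translate g)) T"
    unfolding labelled_rooted_iso_def using labelled_iso_map_comp[OF translation_iso[OF g(1)] iso] g
    by (metis comp_apply flipped_simps(3) r_one)
  then have "flipped_class (\<omega> \<circ> translate g) = D"
    unfolding flipped_class_def T(2) by (rule labelled_class_eqI[OF schreier_graph_flipped])
  then show "\<exists>g\<in>carrier G. D = flipped_class (\<omega> \<circ> translate g)" using g(1) by blast
next
  assume "\<exists>g\<in>carrier G. D = flipped_class (\<omega> \<circ> translate g)"
  then obtain g where g: "g \<in> carrier G" "D = flipped_class (\<omega> \<circ> translate g)" by auto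
  obtain S where S: "schreier_graph m S" "S \<in> flipped_class \<omega>" "labelled_rooted_iso (flipped \<omega>) S"
    unfolding flipped_class_def using nat_copy_in_labelled_class[OF schreier_graph_flipped countable_graph_flipped] .
  obtain T where T: "schreier_graph m T" "T \<in> D" "labelled_rooted_iso (flipped (\<omega> \<circ> translate g)) T"
    unfolding flipped_class_def g(2) using nat_copy_in_labelled_class[OF schreier_graph_flipped countable_graph_flipped] .
  have "labelled_unrooted_iso (flipped (\<omega> \<circ> translate g)) (flipped \<omega>)"
    using translation_iso[OF g(1)] by (auto simp: labelled_unrooted_iso_def)
  then have "labelled_unrooted_iso (flipped (\<omega> \<circ> translate g)) S"
    by (rule labelled_unrooted_iso_trans[OF _ labelled_rooted_imp_unrooted_iso[OF S(3)]])
  then have "labelled_unrooted_iso S (flipped (\<omega> \<circ> translate g))"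
    by (rule labelled_unrooted_iso_sym[OF schreier_graph_flipped])
  then have "labelled_unrooted_iso S T"
    by (rule labelled_unrooted_iso_trans[OF _ labelled_rooted_imp_unrooted_iso[OF T(3)]])
  then show "(flipped_class \<omega>, D) \<in> schreier_rel m"
    using S(2) T(2) flipped_class_in_Lam g(2) unfolding schreier_rel_def by blast
qed

text \<open>The image of the coin space has full measure, and \<open>coins_of\<close> is a measurable inverse on it. Hence
  a function on \<open>Lam m\<close> can be integrated as soon as its composition with \<open>flipped_class\<close> is
  measurable.\<close>

lemma AE_flipped_law_in_range_flipped_class: "AE C in flipped_law. flipped_class (coins_of C) = C"
proof -
  have "{C \<in> space borel_Lam. flipped_class (coins_of C) = C} \<in> sets borel_Lam"
    by (rule sets_Lam_eq[where m = m]) measurable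
  then show ?thesis
    unfolding flipped_law_def by (subst AE_distr_iff[OF measurable_flipped_class]) auto
qed

lemma nn_integral_flipped_law:
  assumes "(\<lambda>\<omega>. f (flipped_class \<omega>)) \<in> borel_measurable coin_flips"
  shows "(\<integral>\<^sup>+C. f C \<partial>flipped_law) = (\<integral>\<^sup>+\<omega>. f (flipped_class \<omega>) \<partial>coin_flips)"
proof -
  have m: "(\<lambda>C. f (flipped_class (coins_of C))) \<in> borel_measurable borel_Lam"
    by (rule measurable_compose[OF measurable_coins_of assms])
  have "(\<integral>\<^sup>+C. f C \<partial>flipped_law) = (\<integral>\<^sup>+C. f (flipped_class (coins_of C)) \<partial>flipped_law)"
    using AE_flipped_law_in_range_flipped_class by (intro nn_integral_cong_AE) auto
  also have "\<dots> = (\<integral>\<^sup>+\<omega>. f (flipped_class (coins_of (flipped_class \<omega>))) \<partial>coin_flips)"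
    unfolding flipped_law_def by (rule nn_integral_distr[OF measurable_flipped_class]) (simp add: m)
  finally show ?thesis by simp
qed

lemma invariant_flipped_law: "flipped_law \<in> invariant_measures m"
proof -
  have "left_counting flipped_law E = right_counting flipped_law E"
    if "E \<in> sets (restrict_space (flipped_law \<Otimes>\<^sub>M flipped_law) (schreier_rel m))" for E
  proof -
    obtain E' where E': "E' \<in> sets (flipped_law \<Otimes>\<^sub>M flipped_law)" "E = schreier_rel m \<inter> E'"
      using \<open>E \<in> _\<close> by (auto simp: sets_restrict_space)
    define e where "e = from_nat_into (carrier G)"
    have e: "e k \<in> carrier G" for k
      unfolding e_def using from_nat_into[of "carrier G"] by auto
    have e_surj: "\<exists>k. g = e k" if "g \<in> carrier G" for g
      using from_nat_into_surj[OF countable_carrier that] unfolding e_def by metis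
    \<comment> \<open>The classes equivalent to \<open>flipped_class \<omega>\<close> are those of the points \<open>T k \<omega>\<close>.\<close>
    define T where "T k \<omega> = \<omega> \<circ> translate (e k)" for k and \<omega> :: "nat \<Rightarrow> bool"
    define T' where "T' k \<omega> = \<omega> \<circ> translate (inv (e k))" for k and \<omega> :: "nat \<Rightarrow> bool"
    define F where "F = {(\<omega>, \<omega>'). (flipped_class \<omega>, flipped_class \<omega>') \<in> E'}"
    have T: "T k \<in> measurable coin_flips coin_flips" for k
      unfolding T_def[abs_def] by (rule measurable_coin_reindex)
    have T'1: "T' k \<in> measurable coin_flips coin_flips" for k
      unfolding T'_def[abs_def] by (rule measurable_coin_reindex)
    have T'2: "distr coin_flips coin_flips (T' k) = coin_flips" for k
      unfolding T'_def[abs_def] using e by (intro distr_coin_reindex inj_translate) auto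
    have inv: "T k (T' k \<omega>) = \<omega>" "T' k (T k \<omega>) = \<omega>" for k \<omega>
      using translate_inv[OF e[of k]] by (auto simp: T_def T'_def fun_eq_iff)
    have rel: "(flipped_class \<omega>, D) \<in> schreier_rel m \<longleftrightarrow> (\<exists>k. D = flipped_class (T k \<omega>))" for \<omega> D
      unfolding schreier_rel_flipped_class T_def using e e_surj by metis
    have F: "{\<omega>. (\<omega>, T k \<omega>) \<in> F} \<in> sets coin_flips" for k
    proof -
      have "(\<lambda>\<omega>. (flipped_class \<omega>, flipped_class (T k \<omega>))) \<in> measurable coin_flips (flipped_law \<Otimes>\<^sub>M flipped_law)"
        using measurable_flipped_class measurable_compose[OF T measurable_flipped_class]
        by (intro measurable_Pair) (simp_all add: measurable_cong_sets[OF refl sets_flipped_law])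
      from measurable_sets[OF this E'(1)] show ?thesis by (simp add: F_def vimage_def)
    qed
    have diag: "{\<omega>. T j \<omega> = T k \<omega>} \<in> sets coin_flips" for j k
    proof -
      have "{\<omega> \<in> space coin_flips. flipped_class (T j \<omega>) = flipped_class (T k \<omega>)} \<in> sets coin_flips"
        by (intro sets_Lam_eq[where m = m] measurable_compose[OF T measurable_flipped_class])
      then show ?thesis by simp
    qed
    note mt = mass_transport[of coin_flips T' T F, OF space_coin_flips T'1 T'2 inv F diag]
    have inj: "inj_on (\<lambda>\<omega>'. (flipped_class \<omega>, flipped_class \<omega>')) A" "inj_on (\<lambda>\<omega>'. (flipped_class \<omega>', flipped_class \<omega>)) A" for \<omega> A
      by (auto simp: inj_on_def)
    have "{p \<in> E. fst p = flipped_class \<omega>} = (\<lambda>\<omega>'. (flipped_class \<omega>, flipped_class \<omega>')) ` {\<omega>'. (\<exists>k. \<omega>' = T k \<omega>) \<and> (\<omega>, \<omega>') \<in> F}" for \<omega>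
      unfolding E'(2) F_def by (auto simp: rel image_iff) blast
    then have left: "emeasure (count_space UNIV) {p \<in> E. fst p = flipped_class \<omega>} =
        emeasure (count_space UNIV) {\<omega>'. (\<exists>k. \<omega>' = T k \<omega>) \<and> (\<omega>, \<omega>') \<in> F}" for \<omega>
      by (simp only: emeasure_count_space_image[OF inj(1)])
    have rel': "(D, flipped_class \<omega>) \<in> schreier_rel m \<longleftrightarrow> (\<exists>\<omega>' k. D = flipped_class \<omega>' \<and> \<omega> = T k \<omega>')" for \<omega> D
    proof
      assume "(D, flipped_class \<omega>) \<in> schreier_rel m"
      then have "(flipped_class \<omega>, D) \<in> schreier_rel m" by (rule schreier_rel_sym)
      then obtain k where D: "D = flipped_class (T k \<omega>)" using rel by blast
      obtain j where j: "inv (e k) = e j" using e_surj[of "inv (e k)"] e by auto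
      have "T j (T k \<omega>) = \<omega>" using inv(2)[of k \<omega>] by (simp add: T_def T'_def j)
      then show "\<exists>\<omega>' k. D = flipped_class \<omega>' \<and> \<omega> = T k \<omega>'" using D by metis
    qed (use rel in auto)
    have "{p \<in> E. snd p = flipped_class \<omega>} = (\<lambda>\<omega>'. (flipped_class \<omega>', flipped_class \<omega>)) ` {\<omega>'. (\<exists>k. \<omega> = T k \<omega>') \<and> (\<omega>', \<omega>) \<in> F}" for \<omega>
      unfolding E'(2) F_def by (auto simp: rel' image_iff) blast
    then have right: "emeasure (count_space UNIV) {p \<in> E. snd p = flipped_class \<omega>} =
        emeasure (count_space UNIV) {\<omega>'. (\<exists>k. \<omega> = T k \<omega>') \<and> (\<omega>', \<omega>) \<in> F}" for \<omega>
      by (simp only: emeasure_count_space_image[OF inj(2)])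
    show ?thesis
      unfolding left_counting_def right_counting_def
      by (subst (1 2) nn_integral_flipped_law) (simp_all only: left right mt)
  qed
  then show ?thesis
    unfolding invariant_measures_def using prob_space_flipped_law by simp
qed

end

section \<open>Nonatomic invariant Schreier structures on a Cayley graph\<close>

theorem theorem6p4:
  fixes G :: "('a, 'b) monoid_scheme" and A :: "'a set"
  assumes "group G" and "infinite (carrier G)" and "\<not> cyclic_group G"
    and "finite A" and "A \<subseteq> carrier G" and "generate G A = carrier G"
    and "\<And>a b. a \<in> A \<Longrightarrow> b \<in> A \<Longrightarrow> a \<noteq> b \<Longrightarrow> group.ord G (a \<otimes>\<^bsub>G\<^esub> b) \<noteq> 2"
  shows "\<exists>gs m. distinct gs \<and> set gs \<subseteq> carrier G \<and> generate G (set gs) = carrier G \<and>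
           m = length gs \<and>
           (\<exists>\<mu>\<in>invariant_measures m. nonatomic \<mu> \<and>
              distr \<mu> (borel_of_topology (topology_Omega m)) (forget m) =
              return (borel_of_topology (topology_Omega m))
                (unlabelled_class m (cayley_graph G gs)))"
proof -
  interpret group G by fact
  obtain a where a: "a \<in> carrier G" "a \<noteq> \<one>\<^bsub>G\<^esub>" "infinite (left_cosets (generate G {a}))"
    using cyclic_if_cyclic_subgroups_finite_index[OF assms(2,4,5,6)] assms(3) by blast
  have "infinite (carrier G - {\<one>\<^bsub>G\<^esub>, a})" using assms(2) by simp
  then obtain x where x: "x \<in> carrier G" "x \<noteq> \<one>\<^bsub>G\<^esub>" "x \<noteq> a"
    by (metis DiffE infinite_imp_nonempty ex_in_conv insertCI)
  \<comment> \<open>The list of generators must have \<open>a\<close> in second place and be distinct, but the generators from the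
    third on must generate \<open>G\<close> without \<open>a\<close>. So \<open>a\<close> is replaced among them by two factors of \<open>a\<close> that
    differ from \<open>\<one>\<close> and \<open>a\<close>.\<close>
  define y where "y = inv\<^bsub>G\<^esub> x \<otimes>\<^bsub>G\<^esub> a"
  have xy: "x \<otimes>\<^bsub>G\<^esub> y = a" using x(1) a(1) by (simp add: y_def m_assoc[symmetric])
  have y: "y \<in> carrier G" "y \<noteq> \<one>\<^bsub>G\<^esub>" "y \<noteq> a"
    using x a xy by (auto simp: y_def)
  define B where "B = (A - {\<one>\<^bsub>G\<^esub>, a}) \<union> {x, y}"
  have B: "finite B" "B \<subseteq> carrier G" "\<one>\<^bsub>G\<^esub> \<notin> B" "a \<notin> B"
    using assms(4,5) x y by (auto simp: B_def)
  have genB: "generate G B = carrier G"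
  proof
    show "generate G B \<subseteq> carrier G" by (rule generate_incl[OF B(2)])
    have xyB: "x \<in> generate G B" "y \<in> generate G B" by (auto simp: B_def intro: generate.incl)
    have "A \<subseteq> generate G B"
    proof
      fix b assume "b \<in> A"
      then consider "b = \<one>\<^bsub>G\<^esub>" | "b = a" | "b \<in> B" by (auto simp: B_def)
      then show "b \<in> generate G B"
        using generate.one[of G B] generate.eng[OF xyB] xy by cases (auto intro: generate.incl)
    qed
    then show "carrier G \<subseteq> generate G B"
      using generate_subgroup_incl[OF _ generate_is_subgroup[OF B(2)]] assms(6) by blast
  qed
  obtain bs where bs: "set bs = B" "distinct bs" using finite_distinct_list[OF B(1)] by auto
  define gs where "gs = \<one>\<^bsub>G\<^esub> # a # bs"
  define H where "H = generate G {a}"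
  have H: "subgroup H G" unfolding H_def by (rule subgroup_generate_singleton[OF a(1)])
  define coset where "coset g = to_nat_on (left_cosets H) (g <#\<^bsub>G\<^esub> H)" for g
  have cnt: "countable (carrier G)"
    using countable_generate[of A] assms(4,5,6) by (simp add: countable_finite)
  have coset_eq: "coset g = coset h \<longleftrightarrow> g <#\<^bsub>G\<^esub> H = h <#\<^bsub>G\<^esub> H" if "g \<in> carrier G" "h \<in> carrier G" for g h
    unfolding coset_def using that cnt by (subst to_nat_on_inj) auto
  interpret flippable_cayley G gs coset
  proof
    show "distinct gs" using bs B(3,4) a(2) by (auto simp: gs_def)
    show "set gs \<subseteq> carrier G" using bs B(2) a(1) by (auto simp: gs_def)
    show "2 \<le> length gs" "gs ! 0 = \<one>\<^bsub>G\<^esub>" "generate G (set (drop 2 gs)) = carrier G"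
      using bs genB by (simp_all add: gs_def)
    show "coset (g \<otimes>\<^bsub>G\<^esub> gs ! 1) = coset g" if g: "g \<in> carrier G" for g
    proof -
      have "inv\<^bsub>G\<^esub> g \<otimes>\<^bsub>G\<^esub> (g \<otimes>\<^bsub>G\<^esub> a) \<in> H"
        using g a(1) by (simp add: m_assoc[symmetric] H_def generate.incl)
      then show ?thesis
        using coset_eq[of g "g \<otimes>\<^bsub>G\<^esub> a"] l_coset_eq_iff[OF H, of g "g \<otimes>\<^bsub>G\<^esub> a"] g a(1)
        by (simp add: gs_def)
    qed
    show "coset (g \<otimes>\<^bsub>G\<^esub> u) = coset (g \<otimes>\<^bsub>G\<^esub> v)"
      if "g \<in> carrier G" "u \<in> carrier G" "v \<in> carrier G" "coset u = coset v" for g u v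
    proof -
      have "inv\<^bsub>G\<^esub> (g \<otimes>\<^bsub>G\<^esub> u) \<otimes>\<^bsub>G\<^esub> (g \<otimes>\<^bsub>G\<^esub> v) = inv\<^bsub>G\<^esub> u \<otimes>\<^bsub>G\<^esub> (inv\<^bsub>G\<^esub> g \<otimes>\<^bsub>G\<^esub> g) \<otimes>\<^bsub>G\<^esub> v"
        using that(1-3) by (simp only: inv_mult_group m_assoc inv_closed m_closed)
      then have "inv\<^bsub>G\<^esub> (g \<otimes>\<^bsub>G\<^esub> u) \<otimes>\<^bsub>G\<^esub> (g \<otimes>\<^bsub>G\<^esub> v) = inv\<^bsub>G\<^esub> u \<otimes>\<^bsub>G\<^esub> v"
        using that(1-3) by simp
      then show ?thesis
        using that by (simp add: coset_eq l_coset_eq_iff[OF H])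
    qed
    have "to_nat_on (left_cosets H) ` left_cosets H = UNIV"
      using a(3) cnt unfolding H_def[symmetric]
      by (intro bij_betw_imp_surj_on[OF to_nat_on_infinite]) auto
    then show "coset ` carrier G = UNIV"
      by (simp add: coset_def[abs_def] image_image)
    show "countable (carrier G)" by fact
  qed
  have "generate G (set gs) = carrier G"
    using generate_incl[OF gs(2)] mono_generate[of "set (drop 2 gs)" "set gs"] generate_rest
    by (auto dest: in_set_dropD)
  then show ?thesis
    using gs(1,2) invariant_flipped_law nonatomic_flipped_law distr_forget_flipped_law by blast
qed

end
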